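(* Let $G$ be an abelian group that is a direct sum of finite cyclic groups and suppose there is no positive integer $n$ with $nG = 0$. Then $\mathrm{Th}(G,+)$ does not have the Schröder–Bernstein property; moreover, there exist two reduced models of $\mathrm{Th}(G,+)$ that are elementarily bi-embeddable but not isomorphic.
   Context: A complete theory $T$ has the Schröder–Bernstein property if any two elementarily bi-embeddable models of $T$ are isomorphic. An abelian group is reduced if it has no nonzero divisible subgroup. *)

theory Defs
  imports "HOL-Algebra.Algebra"
begin

section \<open>First-order logic in the language of one binary function symbol\<close>

datatype tm = Var nat | Add tm tm

datatype fm = Eq tm tm | Neg fm | Conj fm fm | Ex nat fm

primrec vars_tm :: "tm \<Rightarrow> nat set" where
  "vars_tm (Var i) = {i}"
| "vars_tm (Add s t) = vars_tm s \<union> vars_tm t"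

primrec free_vars :: "fm \<Rightarrow> nat set" where
  "free_vars (Eq s t) = vars_tm s \<union> vars_tm t"
| "free_vars (Neg \<phi>) = free_vars \<phi>"
| "free_vars (Conj \<phi> \<psi>) = free_vars \<phi> \<union> free_vars \<psi>"
| "free_vars (Ex i \<phi>) = free_vars \<phi> - {i}"

definition sentence :: "fm \<Rightarrow> bool" where
  "sentence \<phi> \<longleftrightarrow> free_vars \<phi> = {}"

text \<open>
  The function symbol is interpreted by the operation \<open>mult\<close> of the record (groups in HOL-Algebra
  are written multiplicatively). The field \<open>one\<close> is not part of the first-order structure.
\<close>

definition fo_structure :: "'a monoid \<Rightarrow> bool" where
  "fo_structure M \<longleftrightarrow> carrier M \<noteq> {} \<and> (\<forall>x\<in>carrier M. \<forall>y\<in>carrier M. x \<otimes>\<^bsub>M\<^esub> y \<in> carrier M)"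

primrec eval_tm :: "'a monoid \<Rightarrow> (nat \<Rightarrow> 'a) \<Rightarrow> tm \<Rightarrow> 'a" where
  "eval_tm M v (Var i) = v i"
| "eval_tm M v (Add s t) = eval_tm M v s \<otimes>\<^bsub>M\<^esub> eval_tm M v t"

primrec sat :: "'a monoid \<Rightarrow> (nat \<Rightarrow> 'a) \<Rightarrow> fm \<Rightarrow> bool" where
  "sat M v (Eq s t) \<longleftrightarrow> eval_tm M v s = eval_tm M v t"
| "sat M v (Neg \<phi>) \<longleftrightarrow> \<not> sat M v \<phi>"
| "sat M v (Conj \<phi> \<psi>) \<longleftrightarrow> sat M v \<phi> \<and> sat M v \<psi>"
| "sat M v (Ex i \<phi>) \<longleftrightarrow> (\<exists>a\<in>carrier M. sat M (v(i := a)) \<phi>)"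

definition holds_in :: "'a monoid \<Rightarrow> fm \<Rightarrow> bool" where
  "holds_in M \<phi> \<longleftrightarrow> (\<forall>v. range v \<subseteq> carrier M \<longrightarrow> sat M v \<phi>)"

definition Th :: "'a monoid \<Rightarrow> fm set" where
  "Th M = {\<phi>. sentence \<phi> \<and> holds_in M \<phi>}"

definition model_of :: "'a monoid \<Rightarrow> fm set \<Rightarrow> bool" where
  "model_of M T \<longleftrightarrow> fo_structure M \<and> (\<forall>\<phi>\<in>T. holds_in M \<phi>)"

definition elementary_embedding :: "'a monoid \<Rightarrow> 'b monoid \<Rightarrow> ('a \<Rightarrow> 'b) \<Rightarrow> bool" where
  "elementary_embedding M N f \<longleftrightarrow>
     f \<in> carrier M \<rightarrow> carrier N \<and>
     (\<forall>\<phi> v. range v \<subseteq> carrier M \<longrightarrow> (sat M v \<phi> \<longleftrightarrow> sat N (f \<circ> v) \<phi>))"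

definition elementarily_biembeddable :: "'a monoid \<Rightarrow> 'b monoid \<Rightarrow> bool" where
  "elementarily_biembeddable M N \<longleftrightarrow>
     (\<exists>f. elementary_embedding M N f) \<and> (\<exists>g. elementary_embedding N M g)"

text \<open>
  HOL cannot quantify over all types inside a formula, so the property carries the type in which
  the universes of the models are taken. Its failure for one type refutes the unrestricted
  property. The relation \<open>\<cong>\<close> involves only \<open>carrier\<close> and \<open>mult\<close>, hence it is isomorphism of
  first-order structures.
\<close>

definition Schroeder_Bernstein :: "'u itself \<Rightarrow> fm set \<Rightarrow> bool" where
  "Schroeder_Bernstein _ T \<longleftrightarrow>
     (\<forall>(M :: 'u monoid) (N :: 'u monoid). model_of M T \<and> model_of N T \<and> elementarily_biembeddable M N \<longrightarrow> M \<cong> N)"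

section \<open>Divisible and reduced groups\<close>

definition divisible_group :: "'a monoid \<Rightarrow> bool" where
  "divisible_group D \<longleftrightarrow>
     (\<forall>n::nat. n > 0 \<longrightarrow> (\<forall>x\<in>carrier D. \<exists>y\<in>carrier D. y [^]\<^bsub>D\<^esub> n = x))"

definition reduced_group :: "'a monoid \<Rightarrow> bool" where
  "reduced_group G \<longleftrightarrow>
     (\<forall>H. subgroup H G \<and> divisible_group (G\<lparr>carrier := H\<rparr>) \<longrightarrow> H = {\<one>\<^bsub>G\<^esub>})"

end

theory Submission
  imports Defs "HOL-Computational_Algebra.Polynomial" "HOL-Library.Countable"
begin

text \<open>
  Write the direct sum as \<open>S = \<Oplus>\<^sub>i \<int>/q\<^sub>i\<close> inside \<open>P = \<Prod>\<^sub>i \<int>/q\<^sub>i\<close>. If \<open>S \<subseteq> A \<subseteq> B \<subseteq> P\<close> are subgroups with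
  \<open>A/S\<close> and \<open>B/S\<close> torsion-free and divisible, then \<open>A\<close> is an elementary substructure of \<open>B\<close>: positive
  primitive formulas are evaluated coordinatewise in \<open>A\<close> and in \<open>B\<close>, and a Baur-Monk argument reduces
  all formulas to them. No nonzero element of \<open>P\<close> is divisible by all \<open>q\<^sub>i\<close>, so \<open>A\<close> is reduced.

  Choose indices \<open>j\<^sub>k\<close> whose orders have rapidly growing prime power factors, and units \<open>\<alpha>\<^sub>k\<close> modulo
  \<open>q\<^sub>j\<^sub>k\<close> that are congruent to slowly growing integers modulo these factors. With \<open>m\<^sub>k = k! \<Prod>\<^bsub>l<k\<^esub> q\<^sub>j\<^sub>l\<close>,
  a rational polynomial \<open>F/n\<close> gives the element with coordinates \<open>(m\<^sub>k/n) F(\<alpha>\<^sub>k)\<close>, so every space \<open>W\<close> of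
  rational polynomials defines a group \<open>A(W)\<close> with \<open>A(W)/S \<cong> W\<close>. By the growth conditions every
  homomorphism \<open>A(\<rat>[x]) \<rightarrow> A(W)\<close> acts on \<open>\<rat>[x]\<close> as multiplication by a polynomial. For
  \<open>W = {F. F has no linear term}\<close> it is therefore not surjective, whereas multiplication by \<open>\<alpha>\<^sup>2\<close> and the
  inclusion are elementary embeddings in the two directions.
\<close>

section \<open>Positive primitive formulas in cyclic groups\<close>

lemma sat_cong_free_vars:
  assumes "\<And>n. n \<in> free_vars \<phi> \<Longrightarrow> v n = w n"
  shows "sat M v \<phi> \<longleftrightarrow> sat M w \<phi>"
proof -
  have tm: "eval_tm M v t = eval_tm M w t" if "\<And>n. n \<in> vars_tm t \<Longrightarrow> v n = w n" for t v w
    using that by (induction t) auto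
  show ?thesis
    using assms
  proof (induction \<phi> arbitrary: v w)
    case (Eq s t)
    then show ?case using tm[of s v w] tm[of t v w] by auto
  next
    case (Neg \<phi>)
    then show ?case by (metis free_vars.simps(2) sat.simps(2))
  next
    case (Conj \<phi> \<psi>)
    have "sat M v \<phi> \<longleftrightarrow> sat M w \<phi>" by (rule Conj.IH(1)) (use Conj.prems in auto)
    moreover have "sat M v \<psi> \<longleftrightarrow> sat M w \<psi>" by (rule Conj.IH(2)) (use Conj.prems in auto)
    ultimately show ?case by simp
  next
    case (Ex i \<phi>)
    have "sat M (v(i := a)) \<phi> \<longleftrightarrow> sat M (w(i := a)) \<phi>" for a
      by (rule Ex.IH) (use Ex.prems in auto)
    then show ?case by simp
  qed
qed

lemma eval_tm_closed:
  assumes "fo_structure M" "range v \<subseteq> carrier M"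
  shows "eval_tm M v t \<in> carrier M"
  using assms by (induction t) (auto simp: fo_structure_def)

text \<open>Injectivity of \<open>h\<close> settles equations and surjectivity the quantifier;
  closure of \<open>M\<close> under its operation keeps the values of terms in the domain of
  \<open>h\<close>.\<close>

lemma sat_iso:
  assumes "h \<in> iso M N" "fo_structure M" "range v \<subseteq> carrier M"
  shows "sat M v \<phi> \<longleftrightarrow> sat N (h \<circ> v) \<phi>"
proof -
  have bij: "bij_betw h (carrier M) (carrier N)" using assms(1) by (simp add: iso_def)
  have tm: "eval_tm N (h \<circ> v) t = h (eval_tm M v t)" if "range v \<subseteq> carrier M" for v t
    using that
    by (induction t) (use assms(1) eval_tm_closed[OF assms(2)] in \<open>auto simp: iso_def hom_def\<close>)
  show ?thesis
    using assms(3)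
  proof (induction \<phi> arbitrary: v)
    case (Eq s t)
    then show ?case
      using tm[OF Eq] eval_tm_closed[OF assms(2) Eq] bij_betw_imp_inj_on[OF bij]
      by (simp add: inj_on_eq_iff del: comp_apply)
  next
    case (Ex i \<phi>)
    have "sat M (v(i := a)) \<phi> \<longleftrightarrow> sat N ((h \<circ> v)(i := h a)) \<phi>" if "a \<in> carrier M" for a
    proof -
      have "range (v(i := a)) \<subseteq> carrier M" using that Ex.prems by auto
      from Ex.IH[OF this] show ?thesis by (simp add: fun_upd_comp del: fun_upd_apply comp_apply)
    qed
    moreover have "carrier N = h ` carrier M" using bij by (simp add: bij_betw_def)
    ultimately show ?case by (simp del: comp_apply)
  qed auto
qed

section \<open>Positive primitive formulas and the cosets they define in a cyclic group\<close>

primrec pp :: "fm \<Rightarrow> bool" where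
  "pp (Eq s t) \<longleftrightarrow> True"
| "pp (Neg \<phi>) \<longleftrightarrow> False"
| "pp (Conj \<phi> \<psi>) \<longleftrightarrow> pp \<phi> \<and> pp \<psi>"
| "pp (Ex i \<phi>) \<longleftrightarrow> pp \<phi>"

text \<open>The empty conjunction is encoded as a trivially true equation, so that conjunctions of
  positive primitive formulas are again positive primitive.\<close>

primrec conjs :: "fm list \<Rightarrow> fm" where
  "conjs [] = Eq (Var 0) (Var 0)"
| "conjs (\<phi> # l) = Conj \<phi> (conjs l)"

lemma pp_conjs: "pp (conjs l) \<longleftrightarrow> (\<forall>\<phi>\<in>set l. pp \<phi>)"
  by (induction l) auto

lemma sat_conjs: "sat M v (conjs l) \<longleftrightarrow> (\<forall>\<phi>\<in>set l. sat M v \<phi>)"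
  by (induction l) auto

definition Zmod :: "int \<Rightarrow> int monoid" where
  "Zmod m = \<lparr>carrier = {0..<m}, monoid.mult = (\<lambda>x y. (x + y) mod m), one = 0\<rparr>"

lemma Zmod_simps [simp]:
  "carrier (Zmod m) = {0..<m}" "x \<otimes>\<^bsub>Zmod m\<^esub> y = (x + y) mod m"
  by (simp_all add: Zmod_def)

lemma mod_lincomb:
  "(a * (x mod m) + b * (y mod m)) mod m = (a * x + b * y) mod m" for m :: int
  by (metis mod_add_eq mod_mult_right_eq)

text \<open>Witnesses of the existential quantifiers combine linearly along with the solutions, so a
  positive primitive formula defines a subgroup of a power of the cyclic group.\<close>

lemma sat_Zmod_lincomb:
  assumes "pp \<phi>" "m > 0" "range v \<subseteq> {0..<m}" "range w \<subseteq> {0..<m}"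
    and "sat (Zmod m) v \<phi>" "sat (Zmod m) w \<phi>"
  shows "sat (Zmod m) (\<lambda>n. (a * v n + b * w n) mod m) \<phi>"
proof -
  have tm: "eval_tm (Zmod m) (\<lambda>n. (a * v n + b * w n) mod m) t =
      (a * eval_tm (Zmod m) v t + b * eval_tm (Zmod m) w t) mod m"
    for v w :: "nat \<Rightarrow> int" and t
  proof (induction t)
    case (Add s t)
    then show ?case by (simp add: mod_lincomb mod_simps) (simp add: algebra_simps)
  qed simp
  show ?thesis
    using assms(1,3-)
  proof (induction \<phi> arbitrary: v w)
    case (Ex i \<phi>)
    then obtain c d where cd: "c \<in> {0..<m}" "d \<in> {0..<m}"
      "sat (Zmod m) (v(i := c)) \<phi>" "sat (Zmod m) (w(i := d)) \<phi>"
      by auto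
    have "range (v(i := c)) \<subseteq> {0..<m}" "range (w(i := d)) \<subseteq> {0..<m}"
      using Ex.prems cd by auto
    then have "sat (Zmod m) (\<lambda>n. (a * (v(i := c)) n + b * (w(i := d)) n) mod m) \<phi>"
      using Ex.IH Ex.prems(1) cd(3,4) by (metis pp.simps(4))
    moreover have "(\<lambda>n. (a * (v(i := c)) n + b * (w(i := d)) n) mod m) =
        (\<lambda>n. (a * v n + b * w n) mod m)(i := (a * c + b * d) mod m)" by auto
    ultimately show ?case
      using assms(2) by (auto intro!: bexI[of _ "(a * c + b * d) mod m"])
  qed (auto simp: tm)
qed

text \<open>Solutions can be added and subtracted by \<open>sat_Zmod_lincomb\<close>. Hence, with
  the other variables held fixed, the solutions for \<open>x\<close> are empty or a coset of a
  subgroup in which those variables are zero; the subgroup does not depend on the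
  parameters.\<close>

lemma sat_Zmod_coset:
  assumes "pp \<phi>" "m > 0" "range v \<subseteq> {0..<m}" "c \<in> {0..<m}" "c' \<in> {0..<m}"
    and "sat (Zmod m) (v(x := c)) \<phi>"
  shows "sat (Zmod m) (v(x := c')) \<phi> \<longleftrightarrow> sat (Zmod m) ((\<lambda>_. 0)(x := (c' - c) mod m)) \<phi>"
proof
  have r: "range (v(x := c)) \<subseteq> {0..<m}" "range (v(x := c')) \<subseteq> {0..<m}"
    "range ((\<lambda>_. 0)(x := (c' - c) mod m)) \<subseteq> {0..<m}"
    using assms by auto
  {
    assume "sat (Zmod m) (v(x := c')) \<phi>"
    from sat_Zmod_lincomb[OF assms(1,2) r(2,1) this assms(6), of 1 "-1"]
    have "sat (Zmod m) (\<lambda>n. (1 * (v(x := c')) n + -1 * (v(x := c)) n) mod m) \<phi>" .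
    also have "(\<lambda>n. (1 * (v(x := c')) n + -1 * (v(x := c)) n) mod m) = (\<lambda>_. 0)(x := (c' - c) mod m)"
      by auto
    finally show "sat (Zmod m) ((\<lambda>_. 0)(x := (c' - c) mod m)) \<phi>" .
  next
    assume "sat (Zmod m) ((\<lambda>_. 0)(x := (c' - c) mod m)) \<phi>"
    from sat_Zmod_lincomb[OF assms(1,2) r(1,3) assms(6) this, of 1 1]
    have "sat (Zmod m) (\<lambda>n. (1 * (v(x := c)) n + 1 * ((\<lambda>_. 0)(x := (c' - c) mod m)) n) mod m) \<phi>" .
    also have "(\<lambda>n. (1 * (v(x := c)) n + 1 * ((\<lambda>_. 0)(x := (c' - c) mod m)) n) mod m) = v(x := c')"
      using assms(3-5) by (auto simp: fun_eq_iff mod_simps image_subset_iff)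
    finally show "sat (Zmod m) (v(x := c')) \<phi>" .
  }
qed

section \<open>Integer linear forms\<close>

inductive lform :: "((nat \<Rightarrow> int) \<Rightarrow> int) \<Rightarrow> bool" where
  var: "lform (\<lambda>v. v n)"
| comb: "lform f \<Longrightarrow> lform g \<Longrightarrow> lform (\<lambda>v. a * f v + b * g v)"

text \<open>For a linear form, the value at the unit vector is the coefficient of variable
  \<open>x\<close>.\<close>

definition lcoeff :: "nat \<Rightarrow> ((nat \<Rightarrow> int) \<Rightarrow> int) \<Rightarrow> int" where
  "lcoeff x L = L ((\<lambda>_. 0)(x := 1))"

lemma lform_upd:
  assumes "lform L"
  shows "L (v(x := a)) = L (v(x := 0)) + a * lcoeff x L"
  using assms
proof (induction)
  case (comb f g a b)
  then show ?case by (simp add: lcoeff_def algebra_simps)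
qed (auto simp: lcoeff_def)

primrec tm_lform :: "tm \<Rightarrow> (nat \<Rightarrow> int) \<Rightarrow> int" where
  "tm_lform (Var i) = (\<lambda>v. v i)"
| "tm_lform (Add s t) = (\<lambda>v. tm_lform s v + tm_lform t v)"

lemma lform_tm_lform: "lform (tm_lform t)"
proof (induction t)
  case (Add s t)
  from lform.comb[OF this, of 1 1] show ?case by simp
qed (auto intro: lform.var)

lemma eval_tm_Zmod:
  assumes "range v \<subseteq> {0..<m}"
  shows "eval_tm (Zmod m) v t = tm_lform t v mod m"
proof (induction t)
  case (Var i)
  then show ?case using assms by (simp add: image_subset_iff)
next
  case (Add s t)
  then show ?case by (simp add: mod_simps)
qed

section \<open>Subgroups of the product that contain the direct sum\<close>

locale residue_product =
  fixes q :: "'i \<Rightarrow> int"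
  assumes q_pos: "q i > 0"
begin

text \<open>Elements of the product are represented by least nonnegative residues, so that equality
  in the product is equality of functions.\<close>

definition full :: "('i \<Rightarrow> int) set" where
  "full = {x. \<forall>i. 0 \<le> x i \<and> x i < q i}"

definition lincomb :: "int \<Rightarrow> ('i \<Rightarrow> int) \<Rightarrow> int \<Rightarrow> ('i \<Rightarrow> int) \<Rightarrow> 'i \<Rightarrow> int" where
  "lincomb a x b y = (\<lambda>i. (a * x i + b * y i) mod q i)"

definition grp :: "('i \<Rightarrow> int) set \<Rightarrow> ('i \<Rightarrow> int) monoid" where
  "grp A = \<lparr>carrier = A, monoid.mult = (\<lambda>x y i. (x i + y i) mod q i), one = (\<lambda>_. 0)\<rparr>"

definition fsupp :: "('i \<Rightarrow> int) set" where
  "fsupp = {x \<in> full. finite {i. x i \<noteq> 0}}"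

text \<open>Equality modulo the direct sum is congruence modulo \<open>q i\<close> at all but
  finitely many \<open>i\<close>. In this reading the last two clauses say that the quotient of
  \<open>A\<close> by the direct sum is divisible and torsion-free.\<close>

definition good :: "('i \<Rightarrow> int) set \<Rightarrow> bool" where
  "good A \<longleftrightarrow> fsupp \<subseteq> A \<and> A \<subseteq> full \<and>
     (\<forall>x\<in>A. \<forall>y\<in>A. \<forall>a b. lincomb a x b y \<in> A) \<and>
     (\<forall>n>0. \<forall>x\<in>A. \<exists>y\<in>A. finite {i. \<not> q i dvd n * y i - x i}) \<and>
     (\<forall>n>0. \<forall>x\<in>A. finite {i. \<not> q i dvd n * x i} \<longrightarrow> finite {i. x i \<noteq> 0})"

lemma fullD: "x \<in> full \<Longrightarrow> 0 \<le> x i" "x \<in> full \<Longrightarrow> x i < q i"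
  by (auto simp: full_def)

lemma full_mod: "(\<lambda>i. f i mod q i) \<in> full"
  using q_pos by (auto simp: full_def)

lemma full_mod_eq: "x \<in> full \<Longrightarrow> x i mod q i = x i"
  by (simp add: fullD)

lemma full_dvd_iff: "x \<in> full \<Longrightarrow> q i dvd x i \<longleftrightarrow> x i = 0"
  by (metis dvd_0_right dvd_imp_mod_0 full_mod_eq)

lemma lincomb_full: "lincomb a x b y \<in> full"
  unfolding lincomb_def by (rule full_mod)

lemma zero_fsupp: "(\<lambda>_. 0) \<in> fsupp"
  using q_pos by (auto simp: fsupp_def full_def)

lemma goodD:
  assumes "good A"
  shows "fsupp \<subseteq> A" "A \<subseteq> full" "x \<in> A \<Longrightarrow> y \<in> A \<Longrightarrow> lincomb a x b y \<in> A"
    "x \<in> A \<Longrightarrow> x \<in> full" "(\<lambda>_. 0) \<in> A"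
  using assms zero_fsupp unfolding good_def by blast+

lemma good_fsupp: "good fsupp"
proof -
  have "lincomb a x b y \<in> fsupp" if "x \<in> fsupp" "y \<in> fsupp" for a b x y
  proof -
    have "{i. lincomb a x b y i \<noteq> 0} \<subseteq> {i. x i \<noteq> 0} \<union> {i. y i \<noteq> 0}"
      by (auto simp: lincomb_def)
    then show ?thesis using that lincomb_full
      by (auto simp: fsupp_def intro: finite_subset)
  qed
  moreover have "\<exists>y\<in>fsupp. finite {i. \<not> q i dvd n * y i - x i}" if "x \<in> fsupp" for n x
  proof (rule bexI[OF _ zero_fsupp])
    have "{i. \<not> q i dvd n * 0 - x i} \<subseteq> {i. x i \<noteq> 0}" by auto
    then show "finite {i. \<not> q i dvd n * 0 - x i}"
      using that by (auto simp: fsupp_def intro: finite_subset)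
  qed
  ultimately show ?thesis by (auto simp: good_def fsupp_def)
qed

text \<open>Elements of the product that differ at finitely many coordinates differ by an element of
  the direct sum, which lies in \<open>A\<close>.\<close>

lemma good_modify:
  assumes "good A" "x \<in> A" "y \<in> full" "finite {i. x i \<noteq> y i}"
  shows "y \<in> A"
proof -
  let ?d = "lincomb 1 y (-1) x"
  have "{i. ?d i \<noteq> 0} \<subseteq> {i. x i \<noteq> y i}" by (auto simp: lincomb_def)
  then have "?d \<in> fsupp" using assms(4) lincomb_full by (auto simp: fsupp_def intro: finite_subset)
  then have "lincomb 1 x 1 ?d \<in> A" using goodD[OF assms(1)] assms(2) by blast
  moreover have "lincomb 1 x 1 ?d = y"
    using assms(3) by (auto simp: lincomb_def mod_simps full_mod_eq)
  ultimately show ?thesis by simp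
qed

text \<open>The sign of \<open>c\<close> is absorbed into the solution. The plus sign suits the
  later use, where a linear form is made to vanish by choosing one of its variables.\<close>

lemma good_divide:
  assumes "good A" "x \<in> A" "c \<noteq> 0"
  obtains y where "y \<in> A" "finite {i. \<not> q i dvd c * y i + x i}"
proof -
  obtain y where y: "y \<in> A" "finite {i. \<not> q i dvd \<bar>c\<bar> * y i - x i}"
    using assms unfolding good_def by (metis zero_less_abs_iff)
  let ?y = "lincomb (- sgn c) y 0 y"
  have "q i dvd c * ?y i + x i \<longleftrightarrow> q i dvd \<bar>c\<bar> * y i - x i" for i
  proof -
    have "(c * ?y i + x i) mod q i = (c * (- sgn c * y i) + x i) mod q i"
      using mod_lincomb[of c "- sgn c * y i" "q i" 1 "x i"] mod_add_right_eq[of _ "x i" "q i"]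
      by (simp add: lincomb_def)
    also have "c * (- sgn c * y i) + x i = - (\<bar>c\<bar> * y i - x i)"
      by (simp add: abs_sgn)
    finally show ?thesis by (metis dvd_eq_mod_eq_0 dvd_minus_iff)
  qed
  with y(2) have "finite {i. \<not> q i dvd c * ?y i + x i}" by simp
  with goodD(3)[OF assms(1) y(1) y(1)] that show ?thesis by blast
qed

lemma good_torsion_free:
  assumes "good A" "x \<in> A" "c \<noteq> 0" "finite {i. \<not> q i dvd c * x i}"
  shows "finite {i. x i \<noteq> 0}"
proof -
  have "q i dvd \<bar>c\<bar> * x i \<longleftrightarrow> q i dvd c * x i" for i
    by (cases "c \<ge> 0") auto
  with assms show ?thesis unfolding good_def by (metis (mono_tags, lifting) Collect_cong zero_less_abs_iff)
qed

lemma lform_good: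
  assumes "lform L" "good A" "range v \<subseteq> A"
  shows "(\<lambda>i. L (\<lambda>n. v n i) mod q i) \<in> A"
  using assms(1)
proof induction
  case (var n)
  have "v n \<in> A" using assms(3) by auto
  moreover have "(\<lambda>i. v n i mod q i) = v n"
    using goodD(4)[OF assms(2) \<open>v n \<in> A\<close>] by (auto simp: full_mod_eq)
  ultimately show ?case by simp
next
  case (comb f g a b)
  from goodD(3)[OF assms(2) this(3,4), of a b] show ?case
    by (simp add: lincomb_def mod_lincomb)
qed

section \<open>Coordinatewise evaluation of positive primitive formulas\<close>

lemma grp_simps [simp]:
  "carrier (grp A) = A" "x \<otimes>\<^bsub>grp A\<^esub> y = (\<lambda>i. (x i + y i) mod q i)" "\<one>\<^bsub>grp A\<^esub> = (\<lambda>_. 0)"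
  by (simp_all add: grp_def)

lemma eval_tm_grp: "eval_tm (grp A) v t i = eval_tm (Zmod (q i)) (\<lambda>n. v n i) t"
  by (induction t) (auto simp: Zmod_def)

text \<open>Witnesses found modulo the direct sum are correct only off a finite set
  \<open>F\<close>; on a finite set the formula can be checked coordinate by coordinate. Allowing
  every larger finite \<open>F'\<close>, and every change of \<open>v\<close> on it that stays in
  \<open>A\<close>, makes the notion pass through conjunctions and quantifiers.\<close>

definition extends_off_finite :: "('i \<Rightarrow> int) set \<Rightarrow> fm \<Rightarrow> (nat \<Rightarrow> 'i \<Rightarrow> int) \<Rightarrow> bool" where
  "extends_off_finite A \<phi> v \<longleftrightarrow> (\<exists>F. finite F \<and> (\<forall>F' v'. finite F' \<and> F \<subseteq> F' \<and> range v' \<subseteq> A \<and>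
     (\<forall>n i. i \<notin> F' \<longrightarrow> v' n i = v n i) \<and> (\<forall>i\<in>F'. sat (Zmod (q i)) (\<lambda>n. v' n i) \<phi>) \<longrightarrow>
     sat (grp A) v' \<phi>))"

lemma extends_off_finite_Conj:
  assumes "extends_off_finite A \<phi> v" "extends_off_finite A \<psi> v"
  shows "extends_off_finite A (Conj \<phi> \<psi>) v"
proof -
  obtain F1 F2 where "finite F1" "finite F2" and
    F: "\<And>F' v'. finite F' \<and> F1 \<subseteq> F' \<and> range v' \<subseteq> A \<and>
     (\<forall>n i. i \<notin> F' \<longrightarrow> v' n i = v n i) \<and> (\<forall>i\<in>F'. sat (Zmod (q i)) (\<lambda>n. v' n i) \<phi>) \<Longrightarrow> sat (grp A) v' \<phi>"
    "\<And>F' v'. finite F' \<and> F2 \<subseteq> F' \<and> range v' \<subseteq> A \<and>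
     (\<forall>n i. i \<notin> F' \<longrightarrow> v' n i = v n i) \<and> (\<forall>i\<in>F'. sat (Zmod (q i)) (\<lambda>n. v' n i) \<psi>) \<Longrightarrow> sat (grp A) v' \<psi>"
    using assms unfolding extends_off_finite_def by blast
  then show ?thesis
    unfolding extends_off_finite_def
    by (intro exI[of _ "F1 \<union> F2"] conjI allI impI) (simp, metis le_sup_iff sat.simps(3))
qed

text \<open>The witness \<open>a\<close> is kept off \<open>F'\<close> and replaced on
  \<open>F'\<close> by witnesses chosen separately at each coordinate. This is a finite
  modification, so the result stays in \<open>A\<close>.\<close>

lemma extends_off_finite_Ex:
  assumes "good A" "a \<in> A" "extends_off_finite A \<phi> (v(x := a))"
  shows "extends_off_finite A (Ex x \<phi>) v"
proof -
  obtain F where "finite F" and F: "\<And>F' v'. finite F' \<Longrightarrow> F \<subseteq> F' \<Longrightarrow> range v' \<subseteq> A \<Longrightarrow>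
     (\<forall>n i. i \<notin> F' \<longrightarrow> v' n i = (v(x := a)) n i) \<Longrightarrow>
     (\<forall>i\<in>F'. sat (Zmod (q i)) (\<lambda>n. v' n i) \<phi>) \<Longrightarrow> sat (grp A) v' \<phi>"
    using assms(3) unfolding extends_off_finite_def by metis
  have "sat (grp A) v' (Ex x \<phi>)"
    if "finite F'" "F \<subseteq> F'" "range v' \<subseteq> A" "\<forall>n i. i \<notin> F' \<longrightarrow> v' n i = v n i"
      and s: "\<forall>i\<in>F'. sat (Zmod (q i)) (\<lambda>n. v' n i) (Ex x \<phi>)" for F' v'
  proof -
    from s have "\<forall>i\<in>F'. \<exists>c. c \<in> {0..<q i} \<and> sat (Zmod (q i)) ((\<lambda>n. v' n i)(x := c)) \<phi>"
      by (metis Zmod_simps(1) sat.simps(4))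
    then obtain c where c: "\<And>i. i \<in> F' \<Longrightarrow> c i \<in> {0..<q i} \<and> sat (Zmod (q i)) ((\<lambda>n. v' n i)(x := c i)) \<phi>"
      by metis
    let ?a = "\<lambda>i. if i \<in> F' then c i else a i"
    have "?a \<in> full" using c goodD(4)[OF assms(1,2)] by (auto simp: full_def)
    moreover have "{i. a i \<noteq> ?a i} \<subseteq> F'" by auto
    ultimately have a: "?a \<in> A"
      using good_modify[OF assms(1,2)] finite_subset[OF _ that(1)] by blast
    have "(\<lambda>n. (v'(x := ?a)) n i) = (\<lambda>n. v' n i)(x := ?a i)" for i by auto
    then have "sat (grp A) (v'(x := ?a)) \<phi>"
      using that(3,4) a c by (intro F[OF that(1,2)]) (auto simp: image_subset_iff)
    with a show ?thesis by auto
  qed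
  with \<open>finite F\<close> show ?thesis unfolding extends_off_finite_def by metis
qed

text \<open>
  Positive primitive formulas imply integer linear equations in their free variables, and over
  torsion-free divisible groups they are equivalent to them. Applied to \<open>A\<close> modulo the direct sum,
  this yields witnesses in \<open>A\<close> that are correct at all but finitely many coordinates.
\<close>

definition linearization :: "((nat \<Rightarrow> int) \<Rightarrow> int) set \<Rightarrow> fm \<Rightarrow> bool" where
  "linearization \<Lambda> \<phi> \<longleftrightarrow> finite \<Lambda> \<and> (\<forall>L\<in>\<Lambda>. lform L) \<and>
    (\<forall>m v. m > 0 \<and> range v \<subseteq> {0..<m} \<and> sat (Zmod m) v \<phi> \<longrightarrow> (\<forall>L\<in>\<Lambda>. m dvd L v)) \<and>
    (\<forall>A v. good A \<and> range v \<subseteq> A \<and> (\<forall>L\<in>\<Lambda>. finite {i. \<not> q i dvd L (\<lambda>n. v n i)}) \<longrightarrow>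
       extends_off_finite A \<phi> v)"

lemma linearizationD:
  assumes "linearization \<Lambda> \<phi>"
  shows "finite \<Lambda>" "L \<in> \<Lambda> \<Longrightarrow> lform L"
    "m > 0 \<Longrightarrow> range v \<subseteq> {0..<m} \<Longrightarrow> sat (Zmod m) v \<phi> \<Longrightarrow> L \<in> \<Lambda> \<Longrightarrow> m dvd L v"
    "good A \<Longrightarrow> range w \<subseteq> A \<Longrightarrow> (\<And>L. L \<in> \<Lambda> \<Longrightarrow> finite {i. \<not> q i dvd L (\<lambda>n. w n i)}) \<Longrightarrow>
       extends_off_finite A \<phi> w"
  using assms unfolding linearization_def by simp_all

text \<open>The quantifier step is Gaussian elimination. If no form involves \<open>x\<close>, the
  witness zero works. Otherwise a form \<open>p\<close> with nonzero coefficient at \<open>x\<close>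
  serves as pivot: divisibility modulo the direct sum solves \<open>p\<close> for \<open>x\<close>,
  and torsion-freeness allows cancelling the pivot coefficient in the other forms.\<close>

lemma linearization_exists:
  assumes "pp \<phi>"
  shows "\<exists>\<Lambda>. linearization \<Lambda> \<phi>"
  using assms
proof (induction \<phi>)
  case (Eq s t)
  let ?L = "\<lambda>v. 1 * tm_lform s v + (-1) * tm_lform t v"
  have "lform ?L" by (intro lform.comb lform_tm_lform)
  moreover have eq: "m dvd ?L v \<longleftrightarrow> sat (Zmod m) v (Eq s t)" if "range v \<subseteq> {0..<m}" for v m
    using that by (simp add: eval_tm_Zmod mod_eq_dvd_iff)
  moreover have "extends_off_finite A (Eq s t) v"
    if "good A" "range v \<subseteq> A" "finite {i. \<not> q i dvd ?L (\<lambda>n. v n i)}" for A v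
    unfolding extends_off_finite_def
  proof (intro exI[of _ "{i. \<not> q i dvd ?L (\<lambda>n. v n i)}"] conjI that(3) allI impI)
    fix F' v'
    assume *: "finite F' \<and> {i. \<not> q i dvd ?L (\<lambda>n. v n i)} \<subseteq> F' \<and> range v' \<subseteq> A \<and>
       (\<forall>n i. i \<notin> F' \<longrightarrow> v' n i = v n i) \<and> (\<forall>i\<in>F'. sat (Zmod (q i)) (\<lambda>n. v' n i) (Eq s t))"
    have "sat (Zmod (q i)) (\<lambda>n. v' n i) (Eq s t)" for i
    proof (cases "i \<in> F'")
      case False
      then have "q i dvd ?L (\<lambda>n. v n i)" "(\<lambda>n. v' n i) = (\<lambda>n. v n i)" using * by auto
      moreover have "range (\<lambda>n. v n i) \<subseteq> {0..<q i}"
        using that goodD(4) fullD by (auto simp: image_subset_iff)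
      ultimately show ?thesis using eq by metis
    qed (use * in blast)
    then show "sat (grp A) v' (Eq s t)" by (auto simp: eval_tm_grp)
  qed
  ultimately show ?case unfolding linearization_def by (intro exI[of _ "{?L}"]) auto
next
  case (Conj \<phi> \<psi>)
  then obtain \<Lambda>1 \<Lambda>2 where 1: "linearization \<Lambda>1 \<phi>" and 2: "linearization \<Lambda>2 \<psi>" by auto
  show ?case
  proof
    show "linearization (\<Lambda>1 \<union> \<Lambda>2) (Conj \<phi> \<psi>)"
      unfolding linearization_def
    proof (intro conjI allI impI)
      show "finite (\<Lambda>1 \<union> \<Lambda>2)" "\<forall>L\<in>\<Lambda>1 \<union> \<Lambda>2. lform L"
        using 1 2 by (auto simp: linearization_def)
      show "\<forall>L\<in>\<Lambda>1 \<union> \<Lambda>2. m dvd L v"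
        if "0 < m \<and> range v \<subseteq> {0..<m} \<and> sat (Zmod m) v (Conj \<phi> \<psi>)" for m v
        using that linearizationD(3)[OF 1] linearizationD(3)[OF 2] by auto
      show "extends_off_finite A (Conj \<phi> \<psi>) v"
        if "good A \<and> range v \<subseteq> A \<and> (\<forall>L\<in>\<Lambda>1 \<union> \<Lambda>2. finite {i. \<not> q i dvd L (\<lambda>n. v n i)})" for A v
        using that
        by (intro extends_off_finite_Conj linearizationD(4)[OF 1] linearizationD(4)[OF 2]) simp_all
    qed
  qed
next
  case (Ex x \<phi>)
  then obtain \<Lambda> where "linearization \<Lambda> \<phi>" by auto
  note \<Lambda> = linearizationD[OF this]
  have wit: "\<exists>c. range (v(x := c)) \<subseteq> {0..<m} \<and> (\<forall>L\<in>\<Lambda>. m dvd L (v(x := c)))"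
    if "0 < m \<and> range v \<subseteq> {0..<m} \<and> sat (Zmod m) v (Ex x \<phi>)" for m v
  proof -
    from that obtain c where "c \<in> {0..<m}" "sat (Zmod m) (v(x := c)) \<phi>" by auto
    moreover from this(1) have "range (v(x := c)) \<subseteq> {0..<m}" using that by auto
    ultimately show ?thesis using \<Lambda>(3) that by blast
  qed
  have upd: "(\<lambda>n. (v(x := a)) n i) = (\<lambda>n. v n i)(x := a i)" for v and a :: "'i \<Rightarrow> int" and i by auto
  show ?case
  proof (cases "\<exists>p\<in>\<Lambda>. lcoeff x p \<noteq> 0")
    case False
    have L: "L (v(x := c)) = L v" if "L \<in> \<Lambda>" for L v c
      using lform_upd[of L v x] that \<Lambda>(2) False
      by (metis add.right_neutral fun_upd_triv mult_zero_right)
    show ?thesis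
      unfolding linearization_def
    proof (intro exI[of _ \<Lambda>] conjI allI impI ballI \<Lambda>(1,2))
      show "m dvd L v" if "0 < m \<and> range v \<subseteq> {0..<m} \<and> sat (Zmod m) v (Ex x \<phi>)" "L \<in> \<Lambda>" for m v L
        using wit[OF that(1)] L[OF that(2)] that(2) by auto
      show "extends_off_finite A (Ex x \<phi>) v"
        if *: "good A \<and> range v \<subseteq> A \<and> (\<forall>L\<in>\<Lambda>. finite {i. \<not> q i dvd L (\<lambda>n. v n i)})" for A v
      proof (rule extends_off_finite_Ex)
        show "good A" "(\<lambda>_. 0) \<in> A" using * goodD(5) by auto
        have "range (v(x := (\<lambda>_. 0))) \<subseteq> A" using * \<open>(\<lambda>_. 0) \<in> A\<close> by auto
        with * show "extends_off_finite A \<phi> (v(x := (\<lambda>_. 0)))"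
          by (intro \<Lambda>(4)) (simp_all add: upd L del: fun_upd_apply)
      qed
    qed
  next
    case True
    then obtain p where p: "p \<in> \<Lambda>" "lcoeff x p \<noteq> 0" by auto
    define c where "c = lcoeff x p"
    \<comment> \<open>The combination with the pivot \<open>p\<close> in which the coefficient of
      \<open>x\<close> cancels.\<close>
    define R where "R L = (\<lambda>v. c * L v + (- lcoeff x L) * p v)" for L
    have R: "R L (v(x := a)) = R L v" if "L \<in> \<Lambda>" for L v a
    proof -
      have "L (v(x := a)) = L (v(x := 0)) + a * lcoeff x L"
        "p (v(x := a)) = p (v(x := 0)) + a * c" for a
        using lform_upd \<Lambda>(2) that p(1) unfolding c_def by blast+
      from this[of a] this[of "v x"] show ?thesis
        by (simp add: R_def algebra_simps)
    qed
    show ?thesis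
      unfolding linearization_def
    proof (intro exI[of _ "R ` \<Lambda>"] conjI allI impI)
      show "finite (R ` \<Lambda>)" using \<Lambda>(1) by simp
      have "lform (R L)" if "L \<in> \<Lambda>" for L
        unfolding R_def by (intro lform.comb \<Lambda>(2) that p(1))
      then show "\<forall>L\<in>R ` \<Lambda>. lform L" by blast
      show "\<forall>L\<in>R ` \<Lambda>. m dvd L v"
        if *: "0 < m \<and> range v \<subseteq> {0..<m} \<and> sat (Zmod m) v (Ex x \<phi>)" for m v
      proof -
        obtain a where "\<forall>L\<in>\<Lambda>. m dvd L (v(x := a))" using wit[OF *] by auto
        then have "m dvd R L (v(x := a))" if "L \<in> \<Lambda>" for L
          using that p(1) unfolding R_def by (intro dvd_add dvd_mult) auto
        then show ?thesis using R by auto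
      qed
      show "extends_off_finite A (Ex x \<phi>) v"
        if *: "good A \<and> range v \<subseteq> A \<and> (\<forall>L\<in>R ` \<Lambda>. finite {i. \<not> q i dvd L (\<lambda>n. v n i)})" for A v
      proof -
        have gA: "good A" using * by simp
        let ?w = "v(x := (\<lambda>_. 0))"
        have "range ?w \<subseteq> A" using * goodD(5) by auto
        then have z: "(\<lambda>i. p (\<lambda>n. ?w n i) mod q i) \<in> A" using lform_good \<Lambda>(2) p(1) gA by blast
        \<comment> \<open>Divisibility modulo the direct sum makes the pivot form vanish at all but
          finitely many coordinates once \<open>x\<close> takes the value \<open>a\<close>.\<close>
        obtain a where a: "a \<in> A" "finite {i. \<not> q i dvd c * a i + p (\<lambda>n. ?w n i) mod q i}"
          using good_divide[OF gA z] p(2) c_def by blast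
        let ?v = "v(x := a)"
        have rv: "range ?v \<subseteq> A" using * a(1) by auto
        have pa: "finite {i. \<not> q i dvd p (\<lambda>n. ?v n i)}"
        proof -
          have "q i dvd c * a i + p (\<lambda>n. ?w n i) mod q i \<longleftrightarrow> q i dvd p (\<lambda>n. ?v n i)" for i
          proof -
            have "p (\<lambda>n. ?v n i) = p (\<lambda>n. ?w n i) + a i * c"
              unfolding upd c_def by (rule lform_upd[OF \<Lambda>(2)[OF p(1)]])
            then show ?thesis by (simp add: dvd_eq_mod_eq_0 mod_simps algebra_simps)
          qed
          with a(2) show ?thesis by simp
        qed
        have "finite {i. \<not> q i dvd L (\<lambda>n. ?v n i)}" if L: "L \<in> \<Lambda>" for L
        proof -
          let ?l = "\<lambda>i. L (\<lambda>n. ?v n i) mod q i"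
          have lA: "?l \<in> A" using lform_good \<Lambda>(2) L gA rv by blast
          have "q i dvd c * ?l i" if "q i dvd p (\<lambda>n. ?v n i)" "q i dvd R L (\<lambda>n. v n i)" for i
          proof -
            have "q i dvd R L (\<lambda>n. ?v n i)" unfolding upd R[OF L] by (rule that)
            then have "q i dvd c * L (\<lambda>n. ?v n i)"
              unfolding R_def using that(1) by (metis dvd_add_left_iff dvd_mult)
            then show ?thesis by (simp add: dvd_eq_mod_eq_0 mod_simps)
          qed
          then have "{i. \<not> q i dvd c * ?l i} \<subseteq>
              {i. \<not> q i dvd p (\<lambda>n. ?v n i)} \<union> {i. \<not> q i dvd R L (\<lambda>n. v n i)}" by auto
          then have "finite {i. \<not> q i dvd c * ?l i}"
            using pa * L by (auto intro: finite_subset)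
          \<comment> \<open>Where \<open>p\<close> and \<open>R L\<close> vanish, so does
            \<open>c\<close> times \<open>L\<close>; torsion-freeness modulo the direct sum removes
            the factor \<open>c\<close>.\<close>
          then have "finite {i. ?l i \<noteq> 0}"
            using good_torsion_free[OF gA lA] p(2) c_def by blast
          then show ?thesis by (simp add: dvd_eq_mod_eq_0)
        qed
        then show ?thesis by (intro extends_off_finite_Ex[OF gA a(1)] \<Lambda>(4)[OF gA rv])
      qed
    qed
  qed
qed auto

text \<open>Projection to a coordinate is a homomorphism, and homomorphisms preserve positive
  primitive formulas.\<close>

lemma sat_grp_pp_imp:
  assumes "pp \<phi>" "A \<subseteq> full" "range v \<subseteq> A" "sat (grp A) v \<phi>"
  shows "sat (Zmod (q i)) (\<lambda>n. v n i) \<phi>"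
  using assms(1,3,4)
proof (induction \<phi> arbitrary: v)
  case (Eq s t)
  then show ?case by (metis eval_tm_grp sat.simps(1))
next
  case (Ex x \<phi>)
  then obtain a where a: "a \<in> A" "sat (grp A) (v(x := a)) \<phi>" by auto
  then have "range (v(x := a)) \<subseteq> A" using Ex.prems by auto
  then have "sat (Zmod (q i)) (\<lambda>n. (v(x := a)) n i) \<phi>" using Ex.IH Ex.prems(1) a(2) by (metis pp.simps(4))
  moreover have "(\<lambda>n. (v(x := a)) n i) = (\<lambda>n. v n i)(x := a i)" by auto
  moreover have "a i \<in> carrier (Zmod (q i))" using a assms(2) by (auto simp: full_def)
  ultimately show ?case by auto
qed auto

text \<open>For the converse, truth at every coordinate makes all forms of a linearization vanish
  there, so \<open>extends_off_finite\<close> applies; it is used with \<open>v\<close> itself and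
  the finite set \<open>F\<close> it provides.\<close>

lemma sat_grp_pp_iff:
  assumes "good A" "pp \<phi>" "range v \<subseteq> A"
  shows "sat (grp A) v \<phi> \<longleftrightarrow> (\<forall>i. sat (Zmod (q i)) (\<lambda>n. v n i) \<phi>)"
proof
  show "\<forall>i. sat (Zmod (q i)) (\<lambda>n. v n i) \<phi>" if "sat (grp A) v \<phi>"
    using sat_grp_pp_imp[OF assms(2) goodD(2)[OF assms(1)] assms(3) that] by blast
  assume *: "\<forall>i. sat (Zmod (q i)) (\<lambda>n. v n i) \<phi>"
  obtain \<Lambda> where "linearization \<Lambda> \<phi>" using linearization_exists[OF assms(2)] by blast
  note \<Lambda> = linearizationD[OF this]
  have "range (\<lambda>n. v n i) \<subseteq> {0..<q i}" for i
    using assms(3) goodD(4)[OF assms(1)] fullD by (auto simp: image_subset_iff)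
  then have "q i dvd L (\<lambda>n. v n i)" if "L \<in> \<Lambda>" for i L
    using \<Lambda>(3)[OF q_pos] * that by simp
  then have "extends_off_finite A \<phi> v" by (intro \<Lambda>(4)[OF assms(1,3)]) simp
  then obtain F where "finite F" "\<And>F' v'. finite F' \<Longrightarrow> F \<subseteq> F' \<Longrightarrow> range v' \<subseteq> A \<Longrightarrow>
     (\<forall>n i. i \<notin> F' \<longrightarrow> v' n i = v n i) \<Longrightarrow>
     (\<forall>i\<in>F'. sat (Zmod (q i)) (\<lambda>n. v' n i) \<phi>) \<Longrightarrow> sat (grp A) v' \<phi>"
    unfolding extends_off_finite_def by metis
  from this(2)[of F v] \<open>finite F\<close> assms(3) * show "sat (grp A) v \<phi>" by auto
qed

end


section \<open>Elementary extensions of the direct sum\<close>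

lemma card_Diff_UN_insert:
  assumes "finite V"
  shows "card (V - (\<Union>\<phi>\<in>insert e E. Z \<phi>)) =
    card (V - (\<Union>\<phi>\<in>E. Z \<phi>)) - card ((V \<inter> Z e) - (\<Union>\<phi>\<in>E. Z \<phi>))"
proof -
  have "V - (\<Union>\<phi>\<in>insert e E. Z \<phi>) = (V - (\<Union>\<phi>\<in>E. Z \<phi>)) - ((V \<inter> Z e) - (\<Union>\<phi>\<in>E. Z \<phi>))" by auto
  then show ?thesis using assms by (simp only:) (rule card_Diff_subset; auto)
qed

text \<open>By inclusion-exclusion, the number of points outside a union depends only on the sizes
  of the intersections. Removing one set leaves a difference of two counts of the same kind, one of
  them with \<open>U\<close> cut down to \<open>U \<inter> Y e\<close>; hence the induction
  generalises over \<open>U\<close> and \<open>U'\<close>.\<close>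

lemma inclusion_exclusion_transfer:
  assumes "finite E" "finite U" "finite U'"
    and "\<And>T. T \<subseteq> E \<Longrightarrow> card (U \<inter> (\<Inter>\<phi>\<in>T. Y \<phi>)) = card (U' \<inter> (\<Inter>\<phi>\<in>T. Y' \<phi>))"
  shows "card (U - (\<Union>\<phi>\<in>E. Y \<phi>)) = card (U' - (\<Union>\<phi>\<in>E. Y' \<phi>))"
  using assms
proof (induction E arbitrary: U U' rule: finite_induct)
  case empty
  from empty(3)[of "{}"] show ?case by simp
next
  case (insert e E)
  have "card (U - (\<Union>\<phi>\<in>E. Y \<phi>)) = card (U' - (\<Union>\<phi>\<in>E. Y' \<phi>))"
    by (rule insert.IH) (use insert.prems in auto)
  moreover have "card ((U \<inter> Y e) - (\<Union>\<phi>\<in>E. Y \<phi>)) = card ((U' \<inter> Y' e) - (\<Union>\<phi>\<in>E. Y' \<phi>))"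
  proof (rule insert.IH)
    fix T assume "T \<subseteq> E"
    then have "insert e T \<subseteq> insert e E" by auto
    from insert.prems(3)[OF this]
    show "card (U \<inter> Y e \<inter> (\<Inter>\<phi>\<in>T. Y \<phi>)) = card (U' \<inter> Y' e \<inter> (\<Inter>\<phi>\<in>T. Y' \<phi>))"
      by (simp add: Int_assoc)
  qed (use insert.prems in auto)
  ultimately show ?case using insert.prems by (simp only: card_Diff_UN_insert)
qed

section \<open>Simultaneous coset conditions at all coordinates\<close>

context residue_product
begin

text \<open>\<open>Q \<phi> i\<close> is the set of residues allowed by condition
  \<open>\<phi>\<close> at coordinate \<open>i\<close>, and \<open>K \<phi> i\<close> plays the role
  of the subgroup of which it is a coset, unless it is empty. Two families \<open>Q\<close> and
  \<open>Y\<close> with the same \<open>K\<close> will stand for the same formulas with different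
  parameters.\<close>

definition cosets :: "('f \<Rightarrow> 'i \<Rightarrow> int set) \<Rightarrow> ('f \<Rightarrow> 'i \<Rightarrow> int set) \<Rightarrow> 'f set \<Rightarrow> bool" where
  "cosets Q K \<Phi> \<longleftrightarrow> (\<forall>\<phi>\<in>\<Phi>. \<forall>i. \<forall>c\<in>Q \<phi> i \<inter> {0..<q i}. \<forall>c'\<in>{0..<q i}. c' \<in> Q \<phi> i \<longleftrightarrow> c' - c \<in> K \<phi> i)"

lemma cosetsD:
  assumes "cosets Q K \<Phi>" "\<phi> \<in> \<Phi>" "c \<in> Q \<phi> i" "c \<in> {0..<q i}" "c' \<in> {0..<q i}"
  shows "c' \<in> Q \<phi> i \<longleftrightarrow> c' - c \<in> K \<phi> i"
  using assms unfolding cosets_def by blast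

definition solutions :: "('i \<Rightarrow> int) set \<Rightarrow> ('f \<Rightarrow> 'i \<Rightarrow> int set) \<Rightarrow> 'f set \<Rightarrow> ('i \<Rightarrow> int) set" where
  "solutions A Q \<Delta> = {a \<in> A. \<forall>\<phi>\<in>\<Delta>. \<forall>i. a i \<in> Q \<phi> i}"

text \<open>Any choice of local solutions on the finite set \<open>F\<close> is completed by
  \<open>a\<close> off \<open>F\<close>, and this finite modification of \<open>a\<close> stays in
  \<open>A\<close>.\<close>

lemma restrict_solutions:
  assumes "good A" "finite F" "a \<in> solutions A Q \<Delta>"
  shows "(\<lambda>a. restrict a F) ` solutions A Q \<Delta> = PiE F (\<lambda>i. {c \<in> {0..<q i}. \<forall>\<phi>\<in>\<Delta>. c \<in> Q \<phi> i})"
proof (intro equalityI subsetI)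
  fix y assume "y \<in> (\<lambda>a. restrict a F) ` solutions A Q \<Delta>"
  then show "y \<in> PiE F (\<lambda>i. {c \<in> {0..<q i}. \<forall>\<phi>\<in>\<Delta>. c \<in> Q \<phi> i})"
    using goodD(4)[OF assms(1)] fullD by (auto simp: solutions_def)
next
  fix y assume y: "y \<in> PiE F (\<lambda>i. {c \<in> {0..<q i}. \<forall>\<phi>\<in>\<Delta>. c \<in> Q \<phi> i})"
  define b where "b = (\<lambda>i. if i \<in> F then y i else a i)"
  have a: "a \<in> A" "\<forall>\<phi>\<in>\<Delta>. \<forall>i. a i \<in> Q \<phi> i" using assms(3) by (auto simp: solutions_def)
  have "b \<in> full" using y a(1) goodD(4)[OF assms(1)] by (auto simp: b_def full_def PiE_iff)
  moreover have "finite {i. a i \<noteq> b i}"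
    by (rule finite_subset[OF _ assms(2)]) (auto simp: b_def)
  ultimately have "b \<in> A" using good_modify[OF assms(1) a(1)] by blast
  moreover have "\<forall>\<phi>\<in>\<Delta>. \<forall>i. b i \<in> Q \<phi> i" using a(2) y by (auto simp: b_def PiE_iff)
  moreover have "restrict b F = y" using y by (auto simp: b_def PiE_iff extensional_def)
  ultimately show "y \<in> (\<lambda>a. restrict a F) ` solutions A Q \<Delta>"
    by (auto simp: solutions_def)
qed

text \<open>Translation by \<open>d - c\<close> takes the solution \<open>c\<close> to the solution
  \<open>d\<close> and preserves differences modulo \<open>q i\<close>, so it maps the one set
  injectively into the other. Exchanging the roles gives equal sizes.\<close>

lemma card_cosets_le:
  assumes "cosets Q K \<Phi>" "cosets Y K \<Phi>" "\<Delta> \<subseteq> \<Phi>"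
    and per: "\<And>\<phi> h. \<phi> \<in> \<Phi> \<Longrightarrow> h mod q i \<in> K \<phi> i \<longleftrightarrow> h \<in> K \<phi> i"
    and c: "c \<in> {0..<q i}" "\<forall>\<phi>\<in>\<Delta>. c \<in> Q \<phi> i" and d: "d \<in> {0..<q i}" "\<forall>\<phi>\<in>\<Delta>. d \<in> Y \<phi> i"
  shows "card {c \<in> {0..<q i}. \<forall>\<phi>\<in>\<Delta>. c \<in> Q \<phi> i} \<le> card {c \<in> {0..<q i}. \<forall>\<phi>\<in>\<Delta>. c \<in> Y \<phi> i}"
proof (rule card_inj_on_le)
  let ?f = "\<lambda>x. (x - c + d) mod q i"
  show "inj_on ?f {c \<in> {0..<q i}. \<forall>\<phi>\<in>\<Delta>. c \<in> Q \<phi> i}"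
  proof (rule inj_onI)
    fix x x' assume x: "x \<in> {c \<in> {0..<q i}. \<forall>\<phi>\<in>\<Delta>. c \<in> Q \<phi> i}" "x' \<in> {c \<in> {0..<q i}. \<forall>\<phi>\<in>\<Delta>. c \<in> Q \<phi> i}"
    assume "?f x = ?f x'"
    then have "(?f x + (c - d)) mod q i = (?f x' + (c - d)) mod q i" by simp
    then show "x = x'" using x by (simp add: mod_simps)
  qed
  show "?f ` {c \<in> {0..<q i}. \<forall>\<phi>\<in>\<Delta>. c \<in> Q \<phi> i} \<subseteq> {c \<in> {0..<q i}. \<forall>\<phi>\<in>\<Delta>. c \<in> Y \<phi> i}"
  proof (clarify, intro conjI ballI)
    fix x assume x: "x \<in> {0..<q i}" "\<forall>\<phi>\<in>\<Delta>. x \<in> Q \<phi> i"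
    show f: "?f x \<in> {0..<q i}" using q_pos by simp
    fix \<phi> assume "\<phi> \<in> \<Delta>"
    then have \<phi>: "\<phi> \<in> \<Phi>" "c \<in> Q \<phi> i" "d \<in> Y \<phi> i" "x \<in> Q \<phi> i" using assms(3) c d x by auto
    then have "x - c \<in> K \<phi> i" using cosetsD[OF assms(1)] c(1) x(1) by blast
    moreover have "(?f x - d) mod q i = (x - c) mod q i" by (simp add: mod_simps)
    ultimately have "?f x - d \<in> K \<phi> i" using per[OF \<phi>(1)] by metis
    then show "?f x \<in> Y \<phi> i" using cosetsD[OF assms(2) \<phi>(1,3) d(1) f] by blast
  qed
  show "finite {c \<in> {0..<q i}. \<forall>\<phi>\<in>\<Delta>. c \<in> Y \<phi> i}" by (rule finite_subset[of _ "{0..<q i}"]) auto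
qed

text \<open>Off \<open>F\<close>, the difference of two solutions of \<open>\<Delta>\<close> lies in
  every \<open>K \<psi> i\<close> and hence in \<open>K \<phi> i\<close>, so \<open>a\<close>
  inherits \<open>\<phi>\<close> from \<open>a'\<close> there; on \<open>F\<close> the two are
  equal.\<close>

lemma solutions_agree:
  assumes "good A" "cosets Q K \<Phi>" "\<Delta> \<subseteq> \<Phi>" "\<phi> \<in> \<Phi>"
    and K: "\<And>i. i \<notin> F \<Longrightarrow> (\<Inter>\<psi>\<in>\<Delta>. K \<psi> i) \<subseteq> K \<phi> i"
    and "a \<in> solutions A Q \<Delta>" "a' \<in> solutions A Q \<Delta>" "a' \<in> solutions A Q {\<phi>}"
    and "\<And>i. i \<in> F \<Longrightarrow> a i = a' i"
  shows "a \<in> solutions A Q {\<phi>}"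
proof -
  have r: "a i \<in> {0..<q i}" "a' i \<in> {0..<q i}" for i
    using assms(6,7) goodD(4)[OF assms(1)] fullD by (auto simp: solutions_def)
  have "a i \<in> Q \<phi> i" for i
  proof (cases "i \<in> F")
    case False
    have "a i - a' i \<in> K \<psi> i" if "\<psi> \<in> \<Delta>" for \<psi>
    proof -
      have "a i \<in> Q \<psi> i" "a' i \<in> Q \<psi> i" using that assms(6,7) by (auto simp: solutions_def)
      moreover have "\<psi> \<in> \<Phi>" using that assms(3) by auto
      ultimately show ?thesis using r[of i] cosetsD[OF assms(2)] by blast
    qed
    then have "a i - a' i \<in> K \<phi> i" using K[OF False] by blast
    moreover have "a' i \<in> Q \<phi> i" using assms(8) by (auto simp: solutions_def)
    ultimately show ?thesis using r[of i] cosetsD[OF assms(2,4)] by blast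
  qed (use assms(8,9) in \<open>auto simp: solutions_def\<close>)
  then show ?thesis using assms(6) by (auto simp: solutions_def)
qed

text \<open>For each \<open>\<phi>\<close> in \<open>E\<close> there are infinitely many coordinates
  with a shift that respects all of \<open>\<Delta>\<close> but not \<open>\<phi>\<close>. One of
  them is free for use, outside \<open>F\<close> and the finitely many coordinates spent on earlier
  conditions.\<close>

lemma solutions_perturb:
  assumes "good B" "cosets Y K \<Phi>" "\<Delta> \<subseteq> \<Phi>" "finite F" "finite E" "E \<subseteq> \<Phi>"
    and per: "\<And>\<phi> h i. \<phi> \<in> \<Phi> \<Longrightarrow> h mod q i \<in> K \<phi> i \<longleftrightarrow> h \<in> K \<phi> i"
    and inf: "\<And>\<phi>. \<phi> \<in> E \<Longrightarrow> infinite {i. \<not> (\<Inter>\<psi>\<in>\<Delta>. K \<psi> i) \<subseteq> K \<phi> i}"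
    and b: "b \<in> solutions B Y \<Delta>"
  shows "\<exists>b'\<in>solutions B Y \<Delta>. (\<forall>i\<in>F. b' i = b i) \<and> (\<forall>\<phi>\<in>E. \<exists>i. b' i \<notin> Y \<phi> i)"
  using assms(5,6) inf
proof (induction E rule: finite_induct)
  case empty
  then show ?case using b by auto
next
  case (insert e E)
  then obtain b' where b': "b' \<in> solutions B Y \<Delta>" "\<forall>i\<in>F. b' i = b i" "\<forall>\<phi>\<in>E. \<exists>i. b' i \<notin> Y \<phi> i"
    by auto
  \<comment> \<open>\<open>k\<close> records a coordinate at which each earlier condition already
    fails; the new change avoids these coordinates.\<close>
  then obtain k where k: "\<And>\<phi>. \<phi> \<in> E \<Longrightarrow> b' (k \<phi>) \<notin> Y \<phi> (k \<phi>)" by metis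
  have "infinite ({i. \<not> (\<Inter>\<psi>\<in>\<Delta>. K \<psi> i) \<subseteq> K e i} - (F \<union> k ` E))"
    using insert.prems(2)[of e] insert.hyps(1) assms(4) by (intro Diff_infinite_finite) auto
  from infinite_imp_nonempty[OF this]
  obtain j where j: "\<not> (\<Inter>\<psi>\<in>\<Delta>. K \<psi> j) \<subseteq> K e j" "j \<notin> F" "j \<notin> k ` E"
    by blast
  then obtain h where h: "\<And>\<psi>. \<psi> \<in> \<Delta> \<Longrightarrow> h \<in> K \<psi> j" "h \<notin> K e j" by auto
  have B: "b' \<in> B" "\<And>i. 0 \<le> b' i" "\<And>i. b' i < q i"
    using b'(1) goodD(4)[OF assms(1)] fullD by (auto simp: solutions_def)
  show ?case
  proof (cases "b' j \<in> Y e j")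
    case False
    with b' show ?thesis by auto
  next
    case True
    define b'' where "b'' = b'(j := (b' j + h) mod q j)"
    have rng: "b' j \<in> {0..<q j}" "b'' j \<in> {0..<q j}" using B q_pos by (auto simp: b''_def)
    have K: "b'' j - b' j \<in> K \<psi> j \<longleftrightarrow> h \<in> K \<psi> j" if "\<psi> \<in> \<Phi>" for \<psi>
      using per[OF that, of "b'' j - b' j" j] per[OF that, of h j] by (simp add: b''_def mod_simps)
    have "b'' \<in> full" using B q_pos by (auto simp: b''_def full_def)
    moreover have "finite {i. b' i \<noteq> b'' i}"
      by (rule finite_subset[of _ "{j}"]) (auto simp: b''_def)
    ultimately have "b'' \<in> B" using good_modify[OF assms(1) B(1)] by blast
    moreover have "b'' j \<in> Y \<psi> j" if "\<psi> \<in> \<Delta>" for \<psi>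
    proof -
      have "\<psi> \<in> \<Phi>" "b' j \<in> Y \<psi> j" using that assms(3) b'(1) by (auto simp: solutions_def)
      then show ?thesis using K h(1)[OF that] rng cosetsD[OF assms(2)] by blast
    qed
    ultimately have "b'' \<in> solutions B Y \<Delta>" using b'(1) by (auto simp: solutions_def b''_def)
    moreover have "b'' j \<notin> Y e j"
      using K[of e] h(2) rng True insert.prems(1) cosetsD[OF assms(2)] by blast
    moreover have "b'' (k \<phi>) \<notin> Y \<phi> (k \<phi>)" if "\<phi> \<in> E" for \<phi>
      using k[OF that] j(3) that by (auto simp: b''_def)
    moreover have "\<forall>i\<in>F. b'' i = b i" using b'(2) j(2) by (auto simp: b''_def)
    ultimately show ?thesis by blast
  qed
qed

text \<open>
  Conditions that cut out a subgroup of finite index are decided by finitely many coordinates, where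
  inclusion-exclusion counts the solutions; the remaining ones can be falsified one at a time by
  changing a single further coordinate.
\<close>

lemma solutions_transfer:
  assumes "good A" "good B" "finite \<Phi>" "cosets Q K \<Phi>" "cosets Y K \<Phi>"
    and per: "\<And>\<phi> h i. \<phi> \<in> \<Phi> \<Longrightarrow> h mod q i \<in> K \<phi> i \<longleftrightarrow> h \<in> K \<phi> i"
    and ex: "\<And>\<Delta>. \<Delta> \<subseteq> \<Phi> \<Longrightarrow> solutions A Q \<Delta> = {} \<longleftrightarrow> solutions B Y \<Delta> = {}"
    and "a \<in> A"
  shows "\<exists>b\<in>B. \<forall>\<phi>\<in>\<Phi>. (\<forall>i. a i \<in> Q \<phi> i) \<longleftrightarrow> (\<forall>i. b i \<in> Y \<phi> i)"
proof -
  define \<Delta> where "\<Delta> = {\<phi> \<in> \<Phi>. \<forall>i. a i \<in> Q \<phi> i}"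
  \<comment> \<open>The coordinates at which \<open>\<Delta>\<close>, the set of conditions true of
    \<open>a\<close>, does not force differences of solutions to respect \<open>\<phi>\<close>. The
    false conditions with finitely many such coordinates form \<open>E\<close> and are decided on
    the finite set \<open>F\<close>.\<close>
  define bad where "bad \<phi> = {i. \<not> (\<Inter>\<psi>\<in>\<Delta>. K \<psi> i) \<subseteq> K \<phi> i}" for \<phi>
  define E where "E = {\<phi> \<in> \<Phi> - \<Delta>. finite (bad \<phi>)}"
  define F where "F = (\<Union>\<phi>\<in>E. bad \<phi>)"
  have sub: "\<Delta> \<subseteq> \<Phi>" "E \<subseteq> \<Phi>" and fin: "finite E" "finite F"
    using assms(3) by (auto simp: \<Delta>_def E_def F_def)
  have off: "(\<Inter>\<psi>\<in>\<Delta>. K \<psi> i) \<subseteq> K \<phi> i" if "\<phi> \<in> E" "i \<notin> F" for \<phi> i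
    using that by (auto simp: F_def bad_def)
  have a: "a \<in> solutions A Q \<Delta>" using assms(8) by (auto simp: solutions_def \<Delta>_def)
  define r where "r = (\<lambda>x :: 'i \<Rightarrow> int. restrict x F)"
  \<comment> \<open>A condition in \<open>E\<close> depends only on the restriction to
    \<open>F\<close> once \<open>\<Delta>\<close> holds. So one solution of \<open>\<Delta>\<close>
    whose restriction is shared with solutions of each \<open>\<phi>\<close> in \<open>T\<close>
    satisfies all of \<open>T\<close>.\<close>
  have inter: "r ` solutions C Z \<Delta> \<inter> (\<Inter>\<phi>\<in>T. r ` solutions C Z (insert \<phi> \<Delta>)) = r ` solutions C Z (\<Delta> \<union> T)"
    if "good C" "cosets Z K \<Phi>" "T \<subseteq> E" for C Z T
  proof
    show "r ` solutions C Z (\<Delta> \<union> T) \<subseteq> r ` solutions C Z \<Delta> \<inter> (\<Inter>\<phi>\<in>T. r ` solutions C Z (insert \<phi> \<Delta>))"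
      by (fastforce simp: solutions_def)
    show "r ` solutions C Z \<Delta> \<inter> (\<Inter>\<phi>\<in>T. r ` solutions C Z (insert \<phi> \<Delta>)) \<subseteq> r ` solutions C Z (\<Delta> \<union> T)"
    proof
      fix y assume y: "y \<in> r ` solutions C Z \<Delta> \<inter> (\<Inter>\<phi>\<in>T. r ` solutions C Z (insert \<phi> \<Delta>))"
      then obtain c where c: "c \<in> solutions C Z \<Delta>" "y = r c" by auto
      have "c \<in> solutions C Z {\<phi>}" if "\<phi> \<in> T" for \<phi>
      proof -
        have \<phi>: "\<phi> \<in> E" using that \<open>T \<subseteq> E\<close> by auto
        have "y \<in> r ` solutions C Z (insert \<phi> \<Delta>)" using INT_D[OF IntD2[OF y] that] .
        then obtain c' where c': "c' \<in> solutions C Z (insert \<phi> \<Delta>)" "y = r c'" by (elim imageE)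
        have "c i = c' i" if "i \<in> F" for i
          using c(2) c'(2) that unfolding r_def by (metis restrict_apply')
        moreover have "c' \<in> solutions C Z \<Delta>" "c' \<in> solutions C Z {\<phi>}"
          using c'(1) by (auto simp: solutions_def)
        ultimately show ?thesis
          using \<phi> sub off c(1)
          by (intro solutions_agree[OF \<open>good C\<close> \<open>cosets Z K \<Phi>\<close> sub(1), of \<phi> F c c']) auto
      qed
      then have "c \<in> solutions C Z (\<Delta> \<union> T)" using c(1) by (auto simp: solutions_def)
      then show "y \<in> r ` solutions C Z (\<Delta> \<union> T)" using c(2) by auto
    qed
  qed
  have finr: "finite (r ` solutions C Z S)" if "good C" for C Z and S :: "'b set"
  proof (cases "solutions C Z S = {}")
    case False
    then obtain c where "c \<in> solutions C Z S" by auto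
    have "finite {c \<in> {0..<q i}. \<forall>\<phi>\<in>S. c \<in> Z \<phi> i}" for i
      by (rule finite_subset[of _ "{0..<q i}"]) auto
    then show ?thesis
      unfolding r_def restrict_solutions[OF that fin(2) \<open>c \<in> _\<close>] by (intro finite_PiE fin(2))
  qed simp
  have "card (r ` solutions A Q \<Delta> - (\<Union>\<phi>\<in>E. r ` solutions A Q (insert \<phi> \<Delta>))) =
      card (r ` solutions B Y \<Delta> - (\<Union>\<phi>\<in>E. r ` solutions B Y (insert \<phi> \<Delta>)))"
  proof (rule inclusion_exclusion_transfer[OF fin(1) finr[OF assms(1)] finr[OF assms(2)]])
    fix T assume T: "T \<subseteq> E"
    have sT: "\<Delta> \<union> T \<subseteq> \<Phi>" using T sub by auto
    have "card (r ` solutions A Q (\<Delta> \<union> T)) = card (r ` solutions B Y (\<Delta> \<union> T))"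
    proof (cases "solutions A Q (\<Delta> \<union> T) = {}")
      case True
      then show ?thesis using ex[OF sT] by simp
    next
      case False
      then obtain c d where cd: "c \<in> solutions A Q (\<Delta> \<union> T)" "d \<in> solutions B Y (\<Delta> \<union> T)"
        using ex[OF sT] by auto
      have "card {c \<in> {0..<q i}. \<forall>\<phi>\<in>\<Delta> \<union> T. c \<in> Q \<phi> i} = card {c \<in> {0..<q i}. \<forall>\<phi>\<in>\<Delta> \<union> T. c \<in> Y \<phi> i}" for i
      proof -
        have "c i \<in> {0..<q i}" "\<forall>\<phi>\<in>\<Delta> \<union> T. c i \<in> Q \<phi> i" "d i \<in> {0..<q i}" "\<forall>\<phi>\<in>\<Delta> \<union> T. d i \<in> Y \<phi> i"
          using cd goodD(4)[OF assms(1)] goodD(4)[OF assms(2)] fullD by (auto simp: solutions_def)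
        then show ?thesis
          using card_cosets_le[OF assms(4,5) sT per] card_cosets_le[OF assms(5,4) sT per]
          by (metis (no_types, lifting) le_antisym)
      qed
      then show ?thesis
        unfolding r_def restrict_solutions[OF assms(1) fin(2) cd(1)] restrict_solutions[OF assms(2) fin(2) cd(2)]
        by (simp add: card_PiE fin(2))
    qed
    then show "card (r ` solutions A Q \<Delta> \<inter> (\<Inter>\<phi>\<in>T. r ` solutions A Q (insert \<phi> \<Delta>))) =
        card (r ` solutions B Y \<Delta> \<inter> (\<Inter>\<phi>\<in>T. r ` solutions B Y (insert \<phi> \<Delta>)))"
      using inter[OF assms(1,4) T] inter[OF assms(2,5) T] by simp
  qed
  moreover have "r a \<in> r ` solutions A Q \<Delta> - (\<Union>\<phi>\<in>E. r ` solutions A Q (insert \<phi> \<Delta>))"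
  proof -
    have "r a \<notin> r ` solutions A Q (insert \<phi> \<Delta>)" if "\<phi> \<in> E" for \<phi>
    proof
      assume "r a \<in> r ` solutions A Q (insert \<phi> \<Delta>)"
      then obtain c where c: "c \<in> solutions A Q (insert \<phi> \<Delta>)" "r a = r c" by auto
      have "a \<in> solutions A Q {\<phi>}"
      proof (rule solutions_agree[OF assms(1,4) sub(1), of \<phi> F a c])
        show "a i = c i" if "i \<in> F" for i
          using c(2) that unfolding r_def by (metis restrict_apply')
      qed (use that sub off a c(1) in \<open>auto simp: solutions_def\<close>)
      then show False using that by (auto simp: solutions_def E_def \<Delta>_def)
    qed
    then show ?thesis using a by auto
  qed
  \<comment> \<open>The restriction of \<open>a\<close> makes the count for \<open>A\<close>
    positive, and the count for \<open>B\<close> is equal to it.\<close>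
  ultimately have "r ` solutions B Y \<Delta> - (\<Union>\<phi>\<in>E. r ` solutions B Y (insert \<phi> \<Delta>)) \<noteq> {}"
    using finr[OF assms(1)] by (metis card.empty card_gt_0_iff empty_iff finite_Diff less_irrefl)
  then obtain b where b: "b \<in> solutions B Y \<Delta>" "r b \<notin> (\<Union>\<phi>\<in>E. r ` solutions B Y (insert \<phi> \<Delta>))"
    by blast
  \<comment> \<open>The false conditions outside \<open>E\<close> are broken without touching
    \<open>F\<close>, so those in \<open>E\<close> remain false.\<close>
  have "\<exists>b'\<in>solutions B Y \<Delta>. (\<forall>i\<in>F. b' i = b i) \<and> (\<forall>\<phi>\<in>\<Phi> - \<Delta> - E. \<exists>i. b' i \<notin> Y \<phi> i)"
    using assms(3) by (intro solutions_perturb[OF assms(2,5) sub(1) fin(2) _ _ per _ b(1)])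
      (auto simp: E_def bad_def)
  then obtain b' where b': "b' \<in> solutions B Y \<Delta>" "\<forall>i\<in>F. b' i = b i"
      "\<forall>\<phi>\<in>\<Phi> - \<Delta> - E. \<exists>i. b' i \<notin> Y \<phi> i" by blast
  have "\<exists>i. b' i \<notin> Y \<phi> i" if "\<phi> \<in> E" for \<phi>
  proof (rule ccontr)
    assume "\<nexists>i. b' i \<notin> Y \<phi> i"
    then have "b' \<in> solutions B Y (insert \<phi> \<Delta>)" using b'(1) by (auto simp: solutions_def)
    moreover have "r b' = r b" using b'(2) by (auto simp: r_def)
    ultimately show False using b(2) that by (metis UN_I imageI)
  qed
  then have "\<forall>\<phi>\<in>\<Phi>. (\<forall>i. a i \<in> Q \<phi> i) \<longleftrightarrow> (\<forall>i. b' i \<in> Y \<phi> i)"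
    using b'(1,3) by (auto simp: solutions_def \<Delta>_def)
  moreover have "b' \<in> B" using b'(1) by (auto simp: solutions_def)
  ultimately show ?thesis by blast
qed

section \<open>Reduction of all formulas to positive primitive ones\<close>

lemma pp_back_and_forth:
  assumes "good A" "good B" "finite \<Phi>" "\<forall>\<phi>\<in>\<Phi>. pp \<phi>" "range v \<subseteq> A" "range w \<subseteq> B"
    and ex: "\<And>\<Delta>. \<Delta> \<subseteq> \<Phi> \<Longrightarrow> (\<exists>a\<in>A. \<forall>\<phi>\<in>\<Delta>. sat (grp A) (v(x := a)) \<phi>) \<longleftrightarrow>
      (\<exists>b\<in>B. \<forall>\<phi>\<in>\<Delta>. sat (grp B) (w(x := b)) \<phi>)"
    and "a \<in> A"
  shows "\<exists>b\<in>B. \<forall>\<phi>\<in>\<Phi>. sat (grp A) (v(x := a)) \<phi> \<longleftrightarrow> sat (grp B) (w(x := b)) \<phi>"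
proof -
  define Q where "Q u \<phi> i = {c. sat (Zmod (q i)) ((\<lambda>n. u n i)(x := c)) \<phi>}"
    for u :: "nat \<Rightarrow> 'i \<Rightarrow> int" and \<phi> i
  \<comment> \<open>By \<open>sat_Zmod_coset\<close> this subgroup is the same for the parameters
    \<open>v\<close> and \<open>w\<close>, which is what makes \<open>solutions_transfer\<close>
    applicable. Reducing \<open>h\<close> makes membership periodic modulo
    \<open>q i\<close>.\<close>
  define K where "K \<phi> i = {h. sat (Zmod (q i)) ((\<lambda>_. 0)(x := h mod q i)) \<phi>}" for \<phi> i
  have cos: "cosets (Q u) K \<Phi>" if "good C" "range u \<subseteq> C" for C u
    unfolding cosets_def
  proof (intro ballI allI)
    fix \<phi> i c c' assume *: "\<phi> \<in> \<Phi>" "c \<in> Q u \<phi> i \<inter> {0..<q i}" "c' \<in> {0..<q i}"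
    have "range (\<lambda>n. u n i) \<subseteq> {0..<q i}"
      using that goodD(4) fullD by (auto simp: image_subset_iff)
    then show "c' \<in> Q u \<phi> i \<longleftrightarrow> c' - c \<in> K \<phi> i"
      using sat_Zmod_coset[of \<phi> "q i" "\<lambda>n. u n i" c c' x] * assms(4) q_pos by (simp add: Q_def K_def)
  qed
  have sat: "sat (grp C) (u(x := c)) \<phi> \<longleftrightarrow> (\<forall>i. c i \<in> Q u \<phi> i)"
    if "good C" "range u \<subseteq> C" "c \<in> C" "\<phi> \<in> \<Phi>" for C u c \<phi>
  proof -
    have "range (u(x := c)) \<subseteq> C" using that by auto
    moreover have "(\<lambda>n. (u(x := c)) n i) = (\<lambda>n. u n i)(x := c i)" for i by auto
    ultimately show ?thesis
      using sat_grp_pp_iff[OF that(1)] assms(4) that(4) by (simp add: Q_def)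
  qed
  have sol: "solutions C (Q u) \<Delta> = {} \<longleftrightarrow> \<not> (\<exists>c\<in>C. \<forall>\<phi>\<in>\<Delta>. sat (grp C) (u(x := c)) \<phi>)"
    if "good C" "range u \<subseteq> C" "\<Delta> \<subseteq> \<Phi>" for C u \<Delta>
    using sat[OF that(1,2)] that(3) unfolding solutions_def by blast
  have "\<exists>b\<in>B. \<forall>\<phi>\<in>\<Phi>. (\<forall>i. a i \<in> Q v \<phi> i) \<longleftrightarrow> (\<forall>i. b i \<in> Q w \<phi> i)"
  proof (rule solutions_transfer[OF assms(1-3) cos[OF assms(1,5)] cos[OF assms(2,6)] _ _ assms(8)])
    show "h mod q i \<in> K \<phi> i \<longleftrightarrow> h \<in> K \<phi> i" for \<phi> h i by (simp add: K_def)
    show "solutions A (Q v) \<Delta> = {} \<longleftrightarrow> solutions B (Q w) \<Delta> = {}" if "\<Delta> \<subseteq> \<Phi>" for \<Delta>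
      using sol[OF assms(1,5) that] sol[OF assms(2,6) that] ex[OF that] by simp
  qed
  then show ?thesis using sat[OF assms(1,5,8)] sat[OF assms(2,6)] by metis
qed

text \<open>For finite \<open>\<Phi>\<close> this is the semantic content of \<open>\<chi>\<close>
  being a Boolean combination of formulas in \<open>\<Phi>\<close>, uniformly over all good
  subgroups, without constructing the combination.\<close>

definition determines :: "fm set \<Rightarrow> fm \<Rightarrow> bool" where
  "determines \<Phi> \<chi> \<longleftrightarrow> (\<forall>A B v w. good A \<longrightarrow> good B \<longrightarrow> range v \<subseteq> A \<longrightarrow> range w \<subseteq> B \<longrightarrow>
    (\<forall>\<phi>\<in>\<Phi>. sat (grp A) v \<phi> \<longleftrightarrow> sat (grp B) w \<phi>) \<longrightarrow> (sat (grp A) v \<chi> \<longleftrightarrow> sat (grp B) w \<chi>))"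

lemma determinesD:
  assumes "determines \<Phi> \<chi>" "good A" "good B" "range v \<subseteq> A" "range w \<subseteq> B"
    and "\<And>\<phi>. \<phi> \<in> \<Phi> \<Longrightarrow> sat (grp A) v \<phi> \<longleftrightarrow> sat (grp B) w \<phi>"
  shows "sat (grp A) v \<chi> \<longleftrightarrow> sat (grp B) w \<chi>"
  by (rule assms(1)[unfolded determines_def, rule_format, OF assms(2-6)])

lemma pp_determine: "\<exists>\<Phi>. finite \<Phi> \<and> (\<forall>\<phi>\<in>\<Phi>. pp \<phi>) \<and> determines \<Phi> \<chi>"
proof (induction \<chi>)
  case (Eq s t)
  then show ?case by (intro exI[of _ "{Eq s t}"]) (simp add: determines_def)
next
  case (Neg \<chi>)
  then show ?case by (simp add: determines_def)
next
  case (Conj \<chi>1 \<chi>2)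
  then obtain \<Phi>1 \<Phi>2 where 1: "finite \<Phi>1" "\<forall>\<phi>\<in>\<Phi>1. pp \<phi>" "determines \<Phi>1 \<chi>1"
    and 2: "finite \<Phi>2" "\<forall>\<phi>\<in>\<Phi>2. pp \<phi>" "determines \<Phi>2 \<chi>2" by blast
  have "determines (\<Phi>1 \<union> \<Phi>2) (Conj \<chi>1 \<chi>2)"
    unfolding determines_def
  proof (intro allI impI)
    fix A B v w
    assume *: "good A" "good B" "range v \<subseteq> A" "range w \<subseteq> B"
      "\<forall>\<phi>\<in>\<Phi>1 \<union> \<Phi>2. sat (grp A) v \<phi> \<longleftrightarrow> sat (grp B) w \<phi>"
    then show "sat (grp A) v (Conj \<chi>1 \<chi>2) \<longleftrightarrow> sat (grp B) w (Conj \<chi>1 \<chi>2)"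
      using determinesD[OF 1(3) *(1-4)] determinesD[OF 2(3) *(1-4)] by simp
  qed
  with 1 2 show ?case by (intro exI[of _ "\<Phi>1 \<union> \<Phi>2"]) auto
next
  case (Ex x \<chi>)
  then obtain \<Phi> where \<Phi>: "finite \<Phi>" "\<forall>\<phi>\<in>\<Phi>. pp \<phi>" and det: "determines \<Phi> \<chi>" by blast
  \<comment> \<open>The formulas saying that the members of \<open>\<Delta>\<close> have a common
    solution for \<open>x\<close>. Agreement on them for all subsets of \<open>\<Phi>\<close> is the
    hypothesis of \<open>pp_back_and_forth\<close>.\<close>
  define cj where "cj \<Delta> = Ex x (conjs (SOME l. set l = \<Delta>))" for \<Delta>
  have set: "set (SOME l. set l = \<Delta>) = \<Delta>" if "\<Delta> \<subseteq> \<Phi>" for \<Delta>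
  proof -
    have "\<exists>l. set l = \<Delta>" using finite_list finite_subset[OF that \<Phi>(1)] by blast
    then show ?thesis by (rule someI_ex)
  qed
  have step: "sat (grp B) w (Ex x \<chi>)"
    if AB: "good A" "good B" "range v \<subseteq> A" "range w \<subseteq> B"
      and agree: "\<forall>\<phi>\<in>cj ` Pow \<Phi>. sat (grp A) v \<phi> \<longleftrightarrow> sat (grp B) w \<phi>" and s: "sat (grp A) v (Ex x \<chi>)"
    for A B v w
  proof -
    obtain a where a: "a \<in> A" "sat (grp A) (v(x := a)) \<chi>" using s by auto
    have "(\<exists>a\<in>A. \<forall>\<phi>\<in>\<Delta>. sat (grp A) (v(x := a)) \<phi>) \<longleftrightarrow>
        (\<exists>b\<in>B. \<forall>\<phi>\<in>\<Delta>. sat (grp B) (w(x := b)) \<phi>)" if "\<Delta> \<subseteq> \<Phi>" for \<Delta>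
    proof -
      have "sat (grp A) v (cj \<Delta>) \<longleftrightarrow> sat (grp B) w (cj \<Delta>)" using agree that by blast
      then show ?thesis by (simp add: cj_def sat_conjs set[OF that])
    qed
    from pp_back_and_forth[OF AB(1,2) \<Phi> AB(3,4) this a(1)]
    obtain b where b: "b \<in> B" "\<forall>\<phi>\<in>\<Phi>. sat (grp A) (v(x := a)) \<phi> \<longleftrightarrow> sat (grp B) (w(x := b)) \<phi>" by auto
    have "range (v(x := a)) \<subseteq> A" "range (w(x := b)) \<subseteq> B" using AB a(1) b(1) by auto
    from determinesD[OF det AB(1,2) this] a(2) b show ?thesis by auto
  qed
  have "determines (cj ` Pow \<Phi>) (Ex x \<chi>)"
    unfolding determines_def
  proof (intro allI impI)
    fix A B v w
    assume *: "good A" "good B" "range v \<subseteq> A" "range w \<subseteq> B"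
      "\<forall>\<phi>\<in>cj ` Pow \<Phi>. sat (grp A) v \<phi> \<longleftrightarrow> sat (grp B) w \<phi>"
    then have agree': "\<forall>\<phi>\<in>cj ` Pow \<Phi>. sat (grp B) w \<phi> \<longleftrightarrow> sat (grp A) v \<phi>" by blast
    show "sat (grp A) v (Ex x \<chi>) \<longleftrightarrow> sat (grp B) w (Ex x \<chi>)"
      using step[OF *] step[OF *(2,1,4,3) agree'] by blast
  qed
  moreover have "\<forall>\<phi>\<in>cj ` Pow \<Phi>. pp \<phi>" using \<Phi>(2) set by (auto simp: cj_def pp_conjs)
  ultimately show ?case using \<Phi>(1) by (intro exI[of _ "cj ` Pow \<Phi>"]) simp
qed

text \<open>Both groups evaluate positive primitive formulas coordinatewise, hence identically at
  tuples of \<open>A\<close>, and these formulas determine all others.\<close>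

theorem good_elementary:
  assumes "good A" "good B" "A \<subseteq> B" "range v \<subseteq> A"
  shows "sat (grp A) v \<chi> \<longleftrightarrow> sat (grp B) v \<chi>"
proof -
  obtain \<Phi> where \<Phi>: "\<forall>\<phi>\<in>\<Phi>. pp \<phi>" "determines \<Phi> \<chi>" using pp_determine by blast
  have v: "range v \<subseteq> B" using assms(3,4) by auto
  show ?thesis
    using sat_grp_pp_iff[OF assms(1) _ assms(4)] sat_grp_pp_iff[OF assms(2) _ v] \<Phi>(1)
    by (intro determinesD[OF \<Phi>(2) assms(1,2,4) v]) simp
qed

end


section \<open>A sparse sequence of cyclic summands\<close>

lemma dvd_poly_diff: "a - b dvd poly F a - poly F b" for a b :: int
proof (induction F)
  case (pCons c F)
  have "poly (pCons c F) a - poly (pCons c F) b = (a - b) * poly F a + b * (poly F a - poly F b)"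
    by (simp add: algebra_simps)
  with pCons show ?case by (metis dvd_add dvd_mult dvd_triv_left)
qed simp

lemma poly_abs_bound: "\<exists>C d. C \<ge> 0 \<and> (\<forall>x\<ge>1. \<bar>poly F x\<bar> \<le> C * x ^ d)" for F :: "int poly"
proof (induction F)
  case (pCons c F)
  then obtain C d where C: "C \<ge> 0" "\<And>x. x \<ge> 1 \<Longrightarrow> \<bar>poly F x\<bar> \<le> C * x ^ d" by auto
  have "\<bar>poly (pCons c F) x\<bar> \<le> (\<bar>c\<bar> + C) * x ^ Suc d" if "x \<ge> 1" for x
  proof -
    have "\<bar>poly (pCons c F) x\<bar> \<le> \<bar>c\<bar> + x * \<bar>poly F x\<bar>"
      using that by (simp add: abs_mult abs_triangle_ineq[THEN order_trans])
    moreover have "\<bar>c\<bar> * 1 \<le> \<bar>c\<bar> * x ^ Suc d" using that by (intro mult_left_mono one_le_power) auto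
    moreover have "x * \<bar>poly F x\<bar> \<le> x * (C * x ^ d)" using that C(2)[OF that] by (intro mult_left_mono) auto
    ultimately show ?thesis by (simp add: algebra_simps)
  qed
  then show ?case using C(1) by (intro exI[of _ "\<bar>c\<bar> + C"] exI[of _ "Suc d"]) auto
qed (auto intro: exI[of _ 0])

lemma int_dvd_fact: "0 < n \<Longrightarrow> n \<le> int k \<Longrightarrow> n dvd fact k" for n :: int
proof -
  assume n: "0 < n" "n \<le> int k"
  then have "nat n dvd fact k" by (intro dvd_fact) auto
  then have "int (nat n) dvd int (fact k)" by (simp only: int_dvd_int_iff)
  then show ?thesis using n by simp
qed

text \<open>Some \<open>q i\<close> does not divide the factorial of \<open>B\<close>, so a prime
  occurs in it to a higher power than in that factorial. This power exceeds \<open>B\<close>, since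
  positive integers up to \<open>B\<close> divide the factorial.\<close>

lemma unbounded_prime_powers:
  fixes q :: "'i \<Rightarrow> int"
  assumes "\<And>i. q i > 0" "\<And>N. N > 0 \<Longrightarrow> \<exists>i. \<not> q i dvd N"
  shows "\<exists>i p e s. Factorial_Ring.prime p \<and> q i = p ^ e * s \<and> coprime (p ^ e) s \<and> p ^ e > B"
proof -
  obtain i where i: "\<not> q i dvd fact (nat B)" using assms(2)[of "fact (nat B)"] by auto
  then obtain p where p: "Factorial_Ring.prime p" "\<not> multiplicity p (q i) \<le> multiplicity p (fact (nat B) :: int)"
    using multiplicity_le_imp_dvd[of "q i" "fact (nat B)"] assms(1)[of i] by force
  let ?r = "p ^ multiplicity p (q i)"
  have "p > 0" using p(1) prime_gt_0_int by blast
  obtain s where s: "q i = ?r * s" "\<not> p dvd s"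
    using multiplicity_decompose'[of "q i" p] assms(1)[of i] p(1)
    by (metis not_prime_unit less_irrefl)
  have "\<not> ?r dvd (fact (nat B) :: int)"
    using p by (metis fact_nonzero multiplicity_geI not_prime_unit)
  have "?r > B"
  proof (rule ccontr)
    assume "\<not> ?r > B"
    then have "?r dvd fact (nat B)" using \<open>p > 0\<close> by (intro int_dvd_fact) auto
    then show False using \<open>\<not> ?r dvd _\<close> by contradiction
  qed
  moreover have "coprime ?r s" using s(2) p(1) by (simp add: prime_imp_coprime)
  ultimately show ?thesis using p(1) s(1) by metis
qed

text \<open>Of the consecutive integers \<open>k + 1\<close> and \<open>k + 2\<close> one is prime
  to \<open>p\<close>; it becomes \<open>u\<close>. The Chinese remainder theorem then combines it
  with the residue 1 modulo \<open>s\<close>.\<close>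

lemma coprime_lift:
  fixes p s :: int
  assumes "Factorial_Ring.prime p" "coprime (p ^ e) s"
  obtains \<alpha> u where "int k < u" "u \<le> int k + 2" "p ^ e dvd \<alpha> - u" "coprime \<alpha> (p ^ e * s)"
proof -
  have "\<exists>u. int k < u \<and> u \<le> int k + 2 \<and> \<not> p dvd u"
  proof (cases "p dvd int k + 1")
    case True
    have "\<not> p dvd int k + 2"
    proof
      assume "p dvd int k + 2"
      from dvd_diff[OF this True] have "p dvd 1" by simp
      then show False using assms(1) not_prime_unit by blast
    qed
    then show ?thesis by (intro exI[of _ "int k + 2"]) auto
  next
    case False
    then show ?thesis by (intro exI[of _ "int k + 1"]) auto
  qed
  then obtain u where u: "int k < u" "u \<le> int k + 2" "\<not> p dvd u" by auto
  obtain x y where xy: "x * p ^ e + y * s = 1"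
    using assms(2) bezout_int[of "p ^ e" s] by auto
  \<comment> \<open>By the Bezout identity this is congruent to \<open>u\<close> modulo
    \<open>p ^ e\<close> and to 1 modulo \<open>s\<close>.\<close>
  define \<alpha> where "\<alpha> = u * (y * s) + x * p ^ e"
  have ys: "y * s = 1 - x * p ^ e" using xy by simp
  have "\<alpha> = p ^ e * (x - u * x) + u" unfolding \<alpha>_def ys by (simp add: algebra_simps)
  moreover have "\<alpha> = s * (u * y - y) + 1" using xy by (simp add: \<alpha>_def algebra_simps)
  moreover have "coprime u (p ^ e)"
    using u(3) assms(1) by (metis coprime_commute coprime_power_right_iff prime_imp_coprime)
  ultimately have "coprime \<alpha> (p ^ e)" "coprime \<alpha> s" "p ^ e dvd \<alpha> - u"
    by (metis coprime_iff_gcd_eq_1 gcd.commute gcd_add_mult mult.commute add.commute,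
        metis coprime_iff_gcd_eq_1 gcd.commute gcd_add_mult mult.commute add.commute gcd_1_int, simp)
  with u that show ?thesis by simp
qed

text \<open>\<open>r k\<close> will be a prime power factor of \<open>q (j k)\<close>. It is so
  large that the value of a fixed polynomial at the small integer \<open>u k\<close>, even
  multiplied by the square of \<open>m k\<close>, stays below \<open>r k\<close> for large
  \<open>k\<close>; a divisibility by \<open>r k\<close> then forces that value to vanish. As a
  unit, \<open>\<alpha> k\<close> acts invertibly on its coordinate.\<close>

locale sparse_sequence = residue_product q for q :: "'i \<Rightarrow> int" +
  fixes j :: "nat \<Rightarrow> 'i" and r \<alpha> u :: "nat \<Rightarrow> int"
  assumes r_dvd: "r k dvd q (j k)"
    and r_large: "(fact k * (\<Prod>l<k. q (j l)))\<^sup>2 * (int k + 2) ^ k < r k"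
    and u_ge: "int k < u k" and u_le: "u k \<le> int k + 2"
    and \<alpha>_cong: "r k dvd \<alpha> k - u k"
    and \<alpha>_coprime: "coprime (\<alpha> k) (q (j k))"

lemma (in residue_product) sparse_sequence_exists:
  assumes "\<And>N. N > 0 \<Longrightarrow> \<exists>i. \<not> q i dvd N"
  shows "\<exists>j r \<alpha> u. sparse_sequence q j r \<alpha> u"
proof -
  define bd where "bd f k = (fact k * (\<Prod>l<k. q (f l)))\<^sup>2 * (int k + 2) ^ k" for f :: "nat \<Rightarrow> 'i" and k
  define P where "P f k i \<longleftrightarrow> (\<exists>p e s. Factorial_Ring.prime p \<and> q i = p ^ e * s \<and> coprime (p ^ e) s \<and> p ^ e > bd f k)"
    for f k i
  have "\<exists>j. \<forall>k. P j k (j k)"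
  \<comment> \<open>The bound at \<open>k\<close> involves only the indices chosen before
    \<open>k\<close>, so the sequence can be built recursively.\<close>
  proof (rule dependent_wellorder_choice)
    show "P f k i = P g k i" if "\<And>l. l < k \<Longrightarrow> f l = g l" for i f g k
      unfolding P_def bd_def using that by simp
    show "\<exists>i. P f k i" for f k
      unfolding P_def using unbounded_prime_powers[OF q_pos assms] by blast
  qed
  then obtain j where "\<And>k. P j k (j k)" by blast
  then obtain p e s where *: "\<And>k. Factorial_Ring.prime (p k) \<and> q (j k) = p k ^ e k * s k \<and> coprime (p k ^ e k) (s k) \<and> p k ^ e k > bd j k"
    unfolding P_def by metis
  have "\<exists>\<alpha> u. int k < u \<and> u \<le> int k + 2 \<and> p k ^ e k dvd \<alpha> - u \<and> coprime \<alpha> (p k ^ e k * s k)" for k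
    using coprime_lift[of "p k" "e k" "s k"] * by metis
  then obtain \<alpha> u where au: "\<And>k. int k < u k" "\<And>k. u k \<le> int k + 2"
      "\<And>k. p k ^ e k dvd \<alpha> k - u k" "\<And>k. coprime (\<alpha> k) (p k ^ e k * s k)"
    by metis
  have "sparse_sequence q j (\<lambda>k. p k ^ e k) \<alpha> u"
  proof
    fix k
    have qk: "q (j k) = p k ^ e k * s k" "bd j k < p k ^ e k" using *[of k] by blast+
    from qk(1) show "p k ^ e k dvd q (j k)" by simp
    from qk(2) show "(fact k * (\<Prod>l<k. q (j l)))\<^sup>2 * (int k + 2) ^ k < p k ^ e k" unfolding bd_def .
    show "int k < u k" "u k \<le> int k + 2" "p k ^ e k dvd \<alpha> k - u k" by (rule au)+
    show "coprime (\<alpha> k) (q (j k))" unfolding qk(1) by (rule au)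
  qed
  then show ?thesis by blast
qed

section \<open>Consequences of the growth conditions\<close>

context sparse_sequence
begin

text \<open>The factorial makes \<open>m k\<close> divisible by each fixed positive integer from
  some \<open>k\<close> on; the product makes it divisible by all earlier orders.\<close>

definition m :: "nat \<Rightarrow> int" where
  "m k = fact k * (\<Prod>l<k. q (j l))"

lemma m_pos: "m k > 0"
  unfolding m_def using q_pos by (intro mult_pos_pos prod_pos) auto

lemma prod_pos: "(\<Prod>l<k. q (j l)) > 0"
  using q_pos by (intro prod_pos) auto

lemma dvd_m: "0 < n \<Longrightarrow> n \<le> int k \<Longrightarrow> n dvd m k"
  using int_dvd_fact by (simp add: m_def)

lemma q_dvd_prod: "l < k \<Longrightarrow> q (j l) dvd (\<Prod>l<k. q (j l))"
  by (rule dvd_prodI) auto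

lemma mult_dvd_m: "0 < n \<Longrightarrow> n \<le> int l \<Longrightarrow> k < l \<Longrightarrow> n * q (j k) dvd m l"
  using int_dvd_fact q_dvd_prod by (simp add: m_def mult_dvd_mono)

lemma r_large': "(m k)\<^sup>2 * (int k + 2) ^ k < r k"
  unfolding m_def by (rule r_large)

lemma q_increasing: "l < k \<Longrightarrow> q (j l) < q (j k)"
proof -
  assume "l < k"
  have "q (j l) \<le> (\<Prod>l<k. q (j l))" using q_dvd_prod[OF \<open>l < k\<close>] prod_pos by (rule zdvd_imp_le)
  also have "\<dots> \<le> m k"
    using prod_pos[of k] fact_ge_1[of k, where ?'a = int] by (simp add: m_def mult_le_cancel_right1)
  also have "\<dots> \<le> (m k)\<^sup>2" using m_pos[of k] by (simp add: power2_eq_square)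
  also have "\<dots> \<le> (m k)\<^sup>2 * (int k + 2) ^ k" by (simp add: mult_le_cancel_left1)
  also have "\<dots> < r k" by (rule r_large')
  also have "\<dots> \<le> q (j k)" using r_dvd q_pos by (rule zdvd_imp_le)
  finally show ?thesis by simp
qed

lemma inj_j: "inj j"
  by (metis injI less_irrefl linorder_neqE_nat q_increasing)

text \<open>Passing from \<open>\<alpha> k\<close> to the congruent \<open>u k\<close>, the number
  \<open>r k\<close> divides the square of \<open>m k\<close> times the value of \<open>F\<close> at
  \<open>u k\<close>. For large \<open>k\<close> this product is smaller than \<open>r k\<close>, so
  \<open>u k\<close> is a root. Since \<open>u k\<close> exceeds \<open>k\<close>, infinitely many
  \<open>k\<close> yield infinitely many roots.\<close>

lemma poly_eq_0I:
  assumes "infinite {k. q (j k) dvd (m k)\<^sup>2 * poly F (\<alpha> k)}"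
  shows "F = 0"
proof (rule ccontr)
  assume "F \<noteq> 0"
  obtain C d where C: "C \<ge> 0" "\<And>x. x \<ge> 1 \<Longrightarrow> \<bar>poly F x\<bar> \<le> C * x ^ d" using poly_abs_bound by blast
  have zero: "poly F (u k) = 0" if k: "q (j k) dvd (m k)\<^sup>2 * poly F (\<alpha> k)" "k > d + nat C" for k
  proof -
    have "r k dvd (m k)\<^sup>2 * poly F (\<alpha> k)" using r_dvd k(1) by (rule dvd_trans)
    moreover have "r k dvd (m k)\<^sup>2 * (poly F (\<alpha> k) - poly F (u k))"
      using \<alpha>_cong dvd_poly_diff dvd_trans dvd_mult by blast
    ultimately have dvd: "r k dvd (m k)\<^sup>2 * poly F (u k)"
      by (metis dvd_diff_right_iff right_diff_distrib)
    have "\<bar>poly F (u k)\<bar> \<le> C * u k ^ d" using u_ge[of k] by (intro C(2)) auto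
    also have "\<dots> \<le> (int k + 2) ^ (k - d) * (int k + 2) ^ d"
    proof (intro mult_mono power_mono)
      have "C \<le> (int k + 2) ^ 1" using k(2) by simp
      also have "\<dots> \<le> (int k + 2) ^ (k - d)" using k(2) by (intro power_increasing) auto
      finally show "C \<le> (int k + 2) ^ (k - d)" by simp
    qed (use u_ge[of k] u_le[of k] in auto)
    also have "\<dots> = (int k + 2) ^ k" using k(2) by (simp flip: power_add)
    finally have "\<bar>(m k)\<^sup>2 * poly F (u k)\<bar> \<le> (m k)\<^sup>2 * (int k + 2) ^ k"
      by (simp add: abs_mult mult_left_mono)
    then have "\<bar>(m k)\<^sup>2 * poly F (u k)\<bar> < r k" using r_large' by (rule le_less_trans)
    then have "(m k)\<^sup>2 * poly F (u k) = 0" using dvd by (metis dvd_imp_le_int abs_ge_self le_less_trans less_irrefl)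
    then show ?thesis using m_pos[of k] by simp
  qed
  define I where "I = {k. q (j k) dvd (m k)\<^sup>2 * poly F (\<alpha> k)} - {..d + nat C}"
  have "infinite I" unfolding I_def using assms by (intro Diff_infinite_finite) auto
  moreover have "finite I"
  proof (rule finite_subset)
    have fin: "finite {x. poly F x = 0}" using poly_roots_finite[OF \<open>F \<noteq> 0\<close>] .
    \<comment> \<open>A root \<open>x\<close> can equal \<open>u k\<close> only for \<open>k\<close>
      below \<open>x\<close>, so each of the finitely many roots accounts for finitely many
      \<open>k\<close>.\<close>
    show "finite (\<Union>x\<in>{x. poly F x = 0}. {..nat x})" using fin by auto
    show "I \<subseteq> (\<Union>x\<in>{x. poly F x = 0}. {..nat x})"
    proof
      fix k assume "k \<in> I"
      then have "poly F (u k) = 0" by (intro zero) (auto simp: I_def)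
      moreover have "k \<in> {..nat (u k)}" using u_ge[of k] by auto
      ultimately show "k \<in> (\<Union>x\<in>{x. poly F x = 0}. {..nat x})" by blast
    qed
  qed
  ultimately show False by blast
qed

text \<open>A representative of the rational polynomial \<open>F\<close> over \<open>n\<close>, not
  yet reduced modulo \<open>q i\<close>. The division is exact as soon as \<open>n \<le> k\<close>;
  the other coordinates are finitely many and vanish modulo the direct sum.\<close>

definition gen :: "int \<Rightarrow> int poly \<Rightarrow> 'i \<Rightarrow> int" where
  "gen n F i = (if i \<in> range j then (m (the_inv j i) div n) * poly F (\<alpha> (the_inv j i)) else 0)"

lemma gen_j: "gen n F (j k) = (m k div n) * poly F (\<alpha> k)"
  by (simp add: gen_def the_inv_f_f inj_j)

lemma finite_exceptions:
  assumes "\<And>k. int k \<ge> N \<Longrightarrow> P (j k)" "\<And>i. i \<notin> range j \<Longrightarrow> P i"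
  shows "finite {i. \<not> P i}"
proof (rule finite_subset)
  show "{i. \<not> P i} \<subseteq> j ` {..<nat N}"
  proof
    fix i assume "i \<in> {i. \<not> P i}"
    then have i: "\<not> P i" by simp
    then have "i \<in> range j" using assms(2)[of i] by argo
    then obtain k where "i = j k" by (elim rangeE)
    moreover from this have "\<not> int k \<ge> N" using assms(1)[of k] i by argo
    ultimately show "i \<in> j ` {..<nat N}" by auto
  qed
qed simp

text \<open>The class of \<open>x\<close> modulo the direct sum is the rational polynomial with
  numerator \<open>F\<close> and denominator \<open>n\<close>. Keeping the pair allows integer
  polynomials throughout.\<close>

definition approx :: "('i \<Rightarrow> int) \<Rightarrow> int \<Rightarrow> int poly \<Rightarrow> bool" where
  "approx x n F \<longleftrightarrow> finite {i. \<not> q i dvd x i - gen n F i}"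

definition ext :: "int poly set \<Rightarrow> ('i \<Rightarrow> int) set" where
  "ext W = {x \<in> full. \<exists>n>0. \<exists>F\<in>W. approx x n F}"

lemma approx_gen: "approx (\<lambda>i. gen n F i mod q i) n F"
proof -
  have "q i dvd gen n F i mod q i - gen n F i" for i by (simp add: mod_eq_dvd_iff[symmetric])
  then show ?thesis by (simp add: approx_def)
qed

lemma gen_in_ext: "n > 0 \<Longrightarrow> F \<in> W \<Longrightarrow> (\<lambda>i. gen n F i mod q i) \<in> ext W"
  using approx_gen full_mod by (auto simp: ext_def)

lemma m_div_mult: "0 < d \<Longrightarrow> 0 < n \<Longrightarrow> d * n \<le> int k \<Longrightarrow> m k div n = d * (m k div (d * n))"
proof -
  assume *: "0 < d" "0 < n" "d * n \<le> int k"
  then obtain t where "m k = d * n * t" using dvd_m[of "d * n" k] by (auto elim: dvdE)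
  then show ?thesis using * by (simp add: mult.assoc mult.left_commute)
qed

text \<open>The usual addition of fractions over the common denominator \<open>n * n'\<close>, exact
  at all coordinates \<open>j k\<close> with \<open>n * n' \<le> k\<close>.\<close>

lemma approx_lincomb:
  assumes "approx x n F" "approx y n' F'" "n > 0" "n' > 0"
  shows "approx (lincomb a x b y) (n * n') (Polynomial.smult (a * n') F + Polynomial.smult (b * n) F')"
proof -
  let ?G = "Polynomial.smult (a * n') F + Polynomial.smult (b * n) F'"
  have "finite {i. \<not> gen (n * n') ?G i = a * gen n F i + b * gen n' F' i}"
  proof (rule finite_exceptions[of "n * n'"])
    fix k assume "n * n' \<le> int k"
    then have "m k div n = n' * (m k div (n * n'))" "m k div n' = n * (m k div (n * n'))"
      using m_div_mult[of n' n k] m_div_mult[of n n' k] assms(3,4) by (simp_all add: mult.commute)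
    then show "gen (n * n') ?G (j k) = a * gen n F (j k) + b * gen n' F' (j k)"
      by (simp add: gen_j algebra_simps)
  qed (simp add: gen_def)
  moreover have "q i dvd lincomb a x b y i - gen (n * n') ?G i"
    if "q i dvd x i - gen n F i" "q i dvd y i - gen n' F' i"
      "gen (n * n') ?G i = a * gen n F i + b * gen n' F' i" for i
  proof -
    have "q i dvd a * (x i - gen n F i) + b * (y i - gen n' F' i)" using that by simp
    also have "\<dots> = a * x i + b * y i - gen (n * n') ?G i" using that(3) by (simp add: algebra_simps)
    finally show ?thesis by (simp add: lincomb_def dvd_eq_mod_eq_0 mod_simps)
  qed
  then have "{i. \<not> q i dvd lincomb a x b y i - gen (n * n') ?G i} \<subseteq>
      {i. \<not> q i dvd x i - gen n F i} \<union> {i. \<not> q i dvd y i - gen n' F' i} \<union>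
      {i. \<not> gen (n * n') ?G i = a * gen n F i + b * gen n' F' i}" by blast
  ultimately show ?thesis
    using assms(1,2) unfolding approx_def by (metis (no_types, lifting) finite_UnI finite_subset)
qed

text \<open>At almost all \<open>j k\<close>, the order divides \<open>d\<close> times the
  coordinate \<open>gen n F (j k)\<close>. The square of \<open>m k\<close> supplies the missing
  factors to reach the form required by \<open>poly_eq_0I\<close>.\<close>

lemma approx_coeff_0:
  assumes "approx x n F" "n > 0" "d > 0" "finite {i. \<not> q i dvd d * x i}"
  shows "F = 0"
proof (rule poly_eq_0I)
  let ?S = "{i. \<not> q i dvd d * x i} \<union> {i. \<not> q i dvd x i - gen n F i}"
  have "finite ?S" using assms by (simp add: approx_def)
  then have "finite (j -` ?S)" by (intro finite_vimageI inj_j)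
  then have "infinite ({k. d * n \<le> int k} - j -` ?S)"
  proof (intro Diff_infinite_finite)
    have "{k. d * n \<le> int k} = {nat (d * n)..}" by auto
    then show "infinite {k. d * n \<le> int k}" by (simp add: infinite_Ici)
  qed
  moreover have "{k. d * n \<le> int k} - j -` ?S \<subseteq> {k. q (j k) dvd (m k)\<^sup>2 * poly F (\<alpha> k)}"
  proof
    fix k assume "k \<in> {k. d * n \<le> int k} - j -` ?S"
    then have k: "d * n \<le> int k" "q (j k) dvd d * x (j k)" "q (j k) dvd x (j k) - gen n F (j k)" by auto
    have "q (j k) dvd d * x (j k) - d * (x (j k) - gen n F (j k))" using k by (intro dvd_diff) auto
    then have *: "q (j k) dvd d * (m k div n) * poly F (\<alpha> k)" by (simp add: algebra_simps gen_j)
    have "d * n dvd m k" using k(1) assms(2,3) by (intro dvd_m) auto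
    then obtain t where t: "m k = d * n * t" by (auto elim: dvdE)
    then have "m k div n = d * t" using assms(2) by (simp add: mult.assoc mult.left_commute)
    then have "(m k)\<^sup>2 * poly F (\<alpha> k) = (n * n * t) * (d * (m k div n) * poly F (\<alpha> k))"
      using t by (simp add: power2_eq_square)
    with * have "q (j k) dvd (m k)\<^sup>2 * poly F (\<alpha> k)" by (metis dvd_mult)
    then show "k \<in> {k. q (j k) dvd (m k)\<^sup>2 * poly F (\<alpha> k)}" by simp
  qed
  ultimately show "infinite {k. q (j k) dvd (m k)\<^sup>2 * poly F (\<alpha> k)}" using finite_subset by blast
qed

end


section \<open>Groups between the direct sum and the product\<close>

context residue_product
begin

section \<open>The group structure on a good subgroup\<close>

lemma good_add: "good A \<Longrightarrow> x \<in> A \<Longrightarrow> y \<in> A \<Longrightarrow> (\<lambda>i. (x i + y i) mod q i) \<in> A"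
  using goodD(3)[of A x y 1 1] by (simp add: lincomb_def)

lemma comm_group_grp:
  assumes "good A"
  shows "comm_group (grp A)"
proof (rule comm_groupI)
  fix x y z assume "x \<in> carrier (grp A)" "y \<in> carrier (grp A)" "z \<in> carrier (grp A)"
  then show "x \<otimes>\<^bsub>grp A\<^esub> y \<in> carrier (grp A)"
    "x \<otimes>\<^bsub>grp A\<^esub> y \<otimes>\<^bsub>grp A\<^esub> z = x \<otimes>\<^bsub>grp A\<^esub> (y \<otimes>\<^bsub>grp A\<^esub> z)"
    using good_add[OF assms] by (auto simp: mod_simps add.assoc)
next
  fix x assume x: "x \<in> carrier (grp A)"
  then have full: "x \<in> full" using goodD(4)[OF assms] by simp
  then show "\<one>\<^bsub>grp A\<^esub> \<otimes>\<^bsub>grp A\<^esub> x = x" by (auto simp: full_mod_eq)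
  have "lincomb (-1) x 0 x \<in> A" using goodD(3)[OF assms] x by simp
  moreover have "lincomb (-1) x 0 x \<otimes>\<^bsub>grp A\<^esub> x = \<one>\<^bsub>grp A\<^esub>"
    by (auto simp: lincomb_def mod_simps)
  ultimately show "\<exists>y\<in>carrier (grp A). y \<otimes>\<^bsub>grp A\<^esub> x = \<one>\<^bsub>grp A\<^esub>" by auto
qed (use goodD(5)[OF assms] in \<open>auto simp: add.commute\<close>)

lemma fo_structure_grp: "good A \<Longrightarrow> fo_structure (grp A)"
  using good_add goodD(5) by (auto simp: fo_structure_def)

lemma grp_pow:
  assumes "x \<in> full"
  shows "x [^]\<^bsub>grp A\<^esub> (n :: nat) = (\<lambda>i. (int n * x i) mod q i)"
proof (induction n)
  case 0
  then show ?case by (simp add: nat_pow_def)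
next
  case (Suc n)
  have "x [^]\<^bsub>grp A\<^esub> Suc n = x [^]\<^bsub>grp A\<^esub> n \<otimes>\<^bsub>grp A\<^esub> x" by (simp add: nat_pow_def)
  also have "\<dots> = (\<lambda>i. (int (Suc n) * x i) mod q i)"
    unfolding Suc by (auto simp: mod_simps algebra_simps)
  finally show ?case by simp
qed

lemma hom_grp_mult:
  assumes "good A" "good B" "h \<in> hom (grp A) (grp B)" "x \<in> A"
  shows "h (\<lambda>i. (int n * x i) mod q i) = (\<lambda>i. (int n * h x i) mod q i)"
proof -
  interpret A: comm_group "grp A" by (rule comm_group_grp[OF assms(1)])
  interpret B: comm_group "grp B" by (rule comm_group_grp[OF assms(2)])
  have "group_hom (grp A) (grp B) h"
    using assms(3) by (simp add: group_hom_def group_hom_axioms_def)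
  then have "h (x [^]\<^bsub>grp A\<^esub> n) = h x [^]\<^bsub>grp B\<^esub> n"
    using assms(4) by (simp add: group_hom.hom_nat_pow)
  moreover have "h x \<in> B" using assms(3,4) by (auto simp: hom_def)
  ultimately show ?thesis
    using grp_pow goodD(4)[OF assms(1,4)] goodD(4)[OF assms(2)] by simp
qed

text \<open>The difference \<open>s\<close> lies in the direct sum, so the product of the orders
  over its support annihilates it. Its image is then torsion, and torsion elements of
  \<open>B\<close> lie in the direct sum.\<close>

lemma hom_grp_finite_diff:
  assumes "good A" "good B" "h \<in> hom (grp A) (grp B)" "x \<in> A" "y \<in> A" "finite {i. x i \<noteq> y i}"
  shows "finite {i. h x i \<noteq> h y i}"
proof -
  define s where "s = lincomb 1 x (-1) y"
  have s: "s \<in> A" unfolding s_def using assms goodD(3) by blast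
  have hA: "h z \<in> B" if "z \<in> A" for z using assms(3) that by (auto simp: hom_def)
  have supp: "finite {i. s i \<noteq> 0}"
    by (rule finite_subset[OF _ assms(6)]) (auto simp: s_def lincomb_def)
  define N where "N = nat (\<Prod>i\<in>{i. s i \<noteq> 0}. q i)"
  have N: "N > 0" "int N = (\<Prod>i\<in>{i. s i \<noteq> 0}. q i)" using q_pos by (auto simp: N_def prod_pos less_imp_le)
  have "(\<lambda>i. (int N * s i) mod q i) = (\<lambda>_. 0)"
  proof
    fix i show "(int N * s i) mod q i = 0"
    proof (cases "s i = 0")
      case False
      then have "q i dvd int N" unfolding N(2) using supp by (intro dvd_prodI) auto
      then show ?thesis by simp
    qed simp
  qed
  then have "(\<lambda>i. (int N * h s i) mod q i) = h (\<lambda>_. 0)" using hom_grp_mult[OF assms(1-3) s, of N] by simp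
  also have "\<dots> = (\<lambda>_. 0)"
    using hom_grp_mult[OF assms(1-3) s, of 0] by simp
  finally have "(int N * h s i) mod q i = 0" for i by meson
  then have "finite {i. \<not> q i dvd int N * h s i}" by (simp add: dvd_eq_mod_eq_0)
  then have fin: "finite {i. h s i \<noteq> 0}" using good_torsion_free[OF assms(2) hA[OF s], of "int N"] N(1) by simp
  have "s \<otimes>\<^bsub>grp A\<^esub> y = x"
    using goodD(4)[OF assms(1,4)] by (auto simp: s_def lincomb_def mod_simps full_mod_eq)
  then have "h x = h s \<otimes>\<^bsub>grp B\<^esub> h y" using assms(3,5) s by (auto simp: hom_def)
  then have "h x i = h y i" if "h s i = 0" for i
    using that full_mod_eq[OF goodD(4)[OF assms(2) hA[OF assms(5)]]] by simp
  then have "{i. h x i \<noteq> h y i} \<subseteq> {i. h s i \<noteq> 0}" by auto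
  then show ?thesis using fin by (rule finite_subset)
qed

end

context sparse_sequence
begin

section \<open>Subgroups attached to sets of polynomials\<close>

lemma gen_0: "gen n 0 i = 0"
  by (auto simp: gen_def)

text \<open>Division by \<open>d\<close> replaces the denominator \<open>n\<close> by
  \<open>d * n\<close>, so closure of \<open>W\<close> under integer combinations suffices.
  Torsion-freeness is \<open>approx_coeff_0\<close>.\<close>

lemma good_ext:
  assumes "0 \<in> W" "\<And>F G a b. F \<in> W \<Longrightarrow> G \<in> W \<Longrightarrow> Polynomial.smult a F + Polynomial.smult b G \<in> W"
  shows "good (ext W)"
  unfolding good_def
proof (intro conjI ballI allI impI)
  show "ext W \<subseteq> full" by (auto simp: ext_def)
  show "fsupp \<subseteq> ext W"
  proof
    fix x assume x: "x \<in> fsupp"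
    have "{i. \<not> q i dvd x i - gen 1 0 i} \<subseteq> {i. x i \<noteq> 0}" by (auto simp: gen_0)
    then have "approx x 1 0" using x by (auto simp: approx_def fsupp_def intro: finite_subset)
    then show "x \<in> ext W" using x assms(1) by (auto simp: ext_def fsupp_def intro!: exI[of _ 1])
  qed
next
  fix x y a b assume "x \<in> ext W" "y \<in> ext W"
  then obtain n F n' F' where *: "n > 0" "F \<in> W" "approx x n F" "n' > 0" "F' \<in> W" "approx y n' F'"
    by (auto simp: ext_def)
  then show "lincomb a x b y \<in> ext W"
    using approx_lincomb[OF *(3,6,1,4), of a b] assms(2)[OF *(2,5)] lincomb_full
    unfolding ext_def by (auto intro!: exI[of _ "n * n'"])
next
  fix d x assume d: "(d :: int) > 0" and "x \<in> ext W"
  then obtain n F where *: "n > 0" "F \<in> W" "approx x n F" by (auto simp: ext_def)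
  let ?y = "\<lambda>i. gen (d * n) F i mod q i"
  have y: "?y \<in> ext W" using gen_in_ext * d by simp
  have fin: "finite {i. \<not> gen n F i = d * gen (d * n) F i}"
  proof (rule finite_exceptions[of "d * n"])
    show "gen n F (j k) = d * gen (d * n) F (j k)" if "d * n \<le> int k" for k
      using m_div_mult[OF d *(1) that] by (simp add: gen_j)
  qed (simp add: gen_def)
  have "q i dvd d * ?y i - x i" if "q i dvd x i - gen n F i" "gen n F i = d * gen (d * n) F i" for i
  proof -
    have "(d * ?y i - x i) mod q i = (- (x i - gen n F i)) mod q i"
      using that(2) mod_lincomb[of d "gen (d * n) F i" "q i" "-1" "x i"] mod_diff_right_eq[of _ "x i" "q i"]
      by simp
    also have "\<dots> = 0" using that(1) by (metis dvd_eq_mod_eq_0 dvd_minus_iff)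
    finally show ?thesis by (simp add: dvd_eq_mod_eq_0)
  qed
  then have "{i. \<not> q i dvd d * ?y i - x i} \<subseteq>
      {i. \<not> q i dvd x i - gen n F i} \<union> {i. \<not> gen n F i = d * gen (d * n) F i}" by blast
  then have "finite {i. \<not> q i dvd d * ?y i - x i}"
    using fin *(3) unfolding approx_def by (metis (no_types, lifting) finite_UnI finite_subset)
  then show "\<exists>y\<in>ext W. finite {i. \<not> q i dvd d * y i - x i}" by (rule bexI[OF _ y])
next
  fix d x assume d: "(d :: int) > 0" and x: "x \<in> ext W" and fin: "finite {i. \<not> q i dvd d * x i}"
  then obtain n F where *: "n > 0" "F \<in> W" "approx x n F" by (auto simp: ext_def)
  have "F = 0" by (rule approx_coeff_0[OF *(3,1) d fin])
  then have "finite {i. \<not> q i dvd x i}" using *(3) by (simp add: approx_def gen_0)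
  then show "finite {i. x i \<noteq> 0}" using x full_dvd_iff by (simp add: ext_def)
qed

section \<open>Coordinatewise multiplication by squares of units\<close>

definition factor :: "'i \<Rightarrow> int" where
  "factor i = (if i \<in> range j then (\<alpha> (the_inv j i))\<^sup>2 else 1)"

text \<open>On polynomials this is multiplication by the square of the variable, whose image
  consists of polynomials with neither constant nor linear term.\<close>

definition twist :: "('i \<Rightarrow> int) \<Rightarrow> 'i \<Rightarrow> int" where
  "twist x = (\<lambda>i. factor i * x i mod q i)"

lemma twist_coprime: "coprime (factor i) (q i)"
  using \<alpha>_coprime by (auto simp: factor_def the_inv_f_f inj_j)

lemma gen_shift: "gen n (Polynomial.monom 1 2 * F) i =
    factor i * gen n F i"
  by (simp add: gen_def factor_def poly_monom)

text \<open>\<open>factor i\<close> is a unit modulo \<open>q i\<close>, so it can be cancelled from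
  the congruence; this gives the direction from left to right.\<close>

lemma approx_twist: "approx (twist x) n (Polynomial.monom 1 2 * F) \<longleftrightarrow> approx x n F"
proof -
  have "q i dvd twist x i - gen n (Polynomial.monom 1 2 * F) i \<longleftrightarrow> q i dvd x i - gen n F i" for i
  proof -
    have "(twist x i - gen n (Polynomial.monom 1 2 * F) i) mod q i = (factor i * (x i - gen n F i)) mod q i"
      unfolding gen_shift twist_def by (simp add: mod_simps algebra_simps)
    then have "q i dvd twist x i - gen n (Polynomial.monom 1 2 * F) i \<longleftrightarrow> q i dvd factor i * (x i - gen n F i)"
      by (simp only: dvd_eq_mod_eq_0)
    also have "\<dots> \<longleftrightarrow> q i dvd x i - gen n F i"
      using twist_coprime[of i] by (simp add: coprime_dvd_mult_right_iff coprime_commute)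
    finally show ?thesis .
  qed
  then show ?thesis by (simp only: approx_def)
qed

lemma inj_on_twist: "inj_on twist full"
proof (rule inj_onI)
  fix x y assume xy: "x \<in> full" "y \<in> full" and eq: "twist x = twist y"
  show "x = y"
  proof
    fix i
    have "(factor i * x i) mod q i = (factor i * y i) mod q i" using fun_cong[OF eq, of i] by (simp only: twist_def)
    then have "q i dvd factor i * (x i - y i)" by (simp only: mod_eq_dvd_iff right_diff_distrib)
    then have "q i dvd x i - y i"
      using twist_coprime[of i] by (simp add: coprime_dvd_mult_right_iff coprime_commute)
    then have "x i mod q i = y i mod q i" by (simp only: mod_eq_dvd_iff)
    then show "x i = y i" using xy by (simp add: full_mod_eq)
  qed
qed

lemma twist_surj:
  assumes "y \<in> full"
  obtains x where "x \<in> full" "twist x = y"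
proof -
  have "\<exists>c. factor i * c mod q i = y i" for i
  proof -
    obtain a b where "a * factor i + b * q i = 1"
      using twist_coprime[of i] bezout_int by (metis coprime_iff_gcd_eq_1)
    then have "a * factor i = 1 - b * q i" by simp
    then have "factor i * (a * y i) = y i - b * y i * q i"
      by (metis (no_types, opaque_lifting) left_diff_distrib mult.assoc mult.commute mult_1)
    then have "factor i * (a * y i) mod q i = y i"
      using full_mod_eq[OF assms, of i] mod_mult_self1[of "y i" "- (b * y i)" "q i"] by simp
    then show ?thesis by blast
  qed
  then obtain c where c: "\<And>i. factor i * c i mod q i = y i" by metis
  have "twist (\<lambda>i. c i mod q i) = y"
    unfolding twist_def by (simp only: mod_mult_right_eq c)
  then show ?thesis using that full_mod by blast
qed

lemma twist_image: "twist ` ext UNIV = ext (range ((*) (Polynomial.monom 1 2)))"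
proof (intro equalityI subsetI)
  fix y assume "y \<in> twist ` ext UNIV"
  then obtain x n F where "y = twist x" "n > 0" "approx x n F" by (auto simp: ext_def)
  then show "y \<in> ext (range ((*) (Polynomial.monom 1 2)))"
    using approx_twist full_mod unfolding ext_def by (auto simp: twist_def)
next
  fix y assume y: "y \<in> ext (range ((*) (Polynomial.monom 1 2)))"
  then obtain n F where nF: "n > 0" "approx y n (Polynomial.monom 1 2 * F)" by (auto simp: ext_def)
  obtain x where x: "x \<in> full" "twist x = y" using y twist_surj by (auto simp: ext_def)
  then have "x \<in> ext UNIV" using nF approx_twist unfolding ext_def by blast
  then show "y \<in> twist ` ext UNIV" using x(2) by blast
qed

lemma twist_iso: "twist \<in> iso (grp (ext UNIV)) (grp (twist ` ext UNIV))"
proof (rule isoI)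
  show "twist \<in> hom (grp (ext UNIV)) (grp (twist ` ext UNIV))"
    by (rule homI) (auto simp: twist_def mod_simps algebra_simps)
  show "bij_betw twist (carrier (grp (ext UNIV))) (carrier (grp (twist ` ext UNIV)))"
    using inj_on_subset[OF inj_on_twist] by (auto simp: bij_betw_def ext_def)
qed

end


section \<open>Homomorphisms and embeddings\<close>

context sparse_sequence
begin

lemma ext_mono: "W \<subseteq> W' \<Longrightarrow> ext W \<subseteq> ext W'"
  unfolding ext_def by blast

lemma good_ext_UNIV: "good (ext UNIV)"
  by (rule good_ext) auto

text \<open>
  Multiplying by \<open>\<Prod>l<k. q (j l)\<close> kills the coordinates before \<open>j k\<close>, and those after \<open>j k\<close> are
  divisible by \<open>q (j k)\<close>. Hence up to this factor a homomorphism acts on the coordinate \<open>j k\<close> as a scalar.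
\<close>

lemma hom_diagonal:
  assumes B: "good B" and h: "h \<in> hom (grp (ext UNIV)) (grp B)" and n: "0 < n" "n \<le> int k"
  defines "e \<equiv> (\<lambda>i. if i = j k then 1 mod q i else 0)"
  shows "q (j k) dvd (\<Prod>l<k. q (j l)) *
    (h (\<lambda>i. gen n F i mod q i) (j k) - gen n F (j k) * h e (j k))"
proof -
  define A where "A = ext UNIV"
  have A: "good A" unfolding A_def by (rule good_ext_UNIV)
  have h: "h \<in> hom (grp A) (grp B)" using h unfolding A_def .
  define p where "p = (\<Prod>l<k. q (j l))"
  have p: "p > 0" unfolding p_def by (rule prod_pos)
  have qk: "q (j k) > 0" by (rule q_pos)
  define x where "x = (\<lambda>i. gen n F i mod q i)"
  define N where "N = n * q (j k)"
  \<comment> \<open>The part of \<open>x\<close> strictly after \<open>j k\<close>, divided by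
    \<open>q (j k)\<close>: the enlarged denominator \<open>N\<close> still divides
    \<open>m l\<close> for \<open>l > k\<close>.\<close>
  define y where "y = (\<lambda>i. if i \<in> j ` {..k} then 0 else gen N F i mod q i)"
  have N: "N > 0" using n qk by (simp add: N_def)
  have xA: "x \<in> A" unfolding x_def A_def using gen_in_ext n by auto
  have yA: "y \<in> A"
  proof (rule good_modify[OF A])
    show "(\<lambda>i. gen N F i mod q i) \<in> A" unfolding A_def using gen_in_ext N by auto
    show "y \<in> full" using q_pos by (auto simp: y_def full_def)
    show "finite {i. gen N F i mod q i \<noteq> y i}"
      by (rule finite_subset[of _ "j ` {..k}"]) (auto simp: y_def)
  qed
  have "e \<in> full" using q_pos by (auto simp: e_def full_def)
  moreover have "finite {i. e i \<noteq> 0}" by (rule finite_subset[of _ "{j k}"]) (auto simp: e_def)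
  ultimately have eA: "e \<in> A" using goodD(1)[OF A] by (auto simp: fsupp_def)
  define c1 c2 where "c1 = nat (p * x (j k))" and "c2 = nat (p * q (j k))"
  have c: "int c1 = p * x (j k)" "int c2 = p * q (j k)" "int (nat p) = p"
    using p qk by (simp_all add: c1_def c2_def x_def)
  have jeq: "j l = j l' \<longleftrightarrow> l = l'" for l l' using inj_j by (auto dest: injD)
  \<comment> \<open>After multiplication by \<open>p\<close>, the element \<open>x\<close> is a
    multiple of the unit vector \<open>e\<close> plus \<open>q (j k)\<close> times a multiple of
    \<open>y\<close>. The image of the last term vanishes at coordinate \<open>j k\<close>.\<close>
  have decomp: "(\<lambda>i. int (nat p) * x i mod q i) =
      (\<lambda>i. (int c1 * e i mod q i + int c2 * y i mod q i) mod q i)"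
  proof
    fix i
    show "int (nat p) * x i mod q i = (int c1 * e i mod q i + int c2 * y i mod q i) mod q i"
    proof (cases "i \<in> range j")
      case False
      then show ?thesis by (auto simp: x_def e_def y_def gen_def)
    next
      case True
      then obtain l where l: "i = j l" by auto
      consider "l < k" | "l = k" | "k < l" by linarith
      then show ?thesis
      proof cases
        case 1
        then have "q i dvd p" unfolding p_def l by (rule q_dvd_prod)
        moreover have "e i = 0" "y i = 0" using 1 by (auto simp: e_def y_def l jeq)
        ultimately show ?thesis unfolding c by simp
      next
        case 2
        then have "y i = 0" "e i = 1 mod q i" by (auto simp: e_def y_def l)
        then show ?thesis unfolding c 2 l by (simp add: mod_simps)
      next
        case 3
        then have "e i = 0" "y i = gen N F i mod q i" by (auto simp: e_def y_def l jeq)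
        moreover have "gen n F i = q (j k) * gen N F i"
        proof -
          obtain t where "m l = N * t" using mult_dvd_m[of n l k] n 3 by (auto simp: N_def elim: dvdE)
          then have "m l div n = q (j k) * (m l div N)" using n N by (simp add: N_def mult.assoc)
          then show ?thesis by (simp add: l gen_j)
        qed
        ultimately show ?thesis unfolding c x_def by (simp add: mod_simps flip: mult.assoc)
      qed
    qed
  qed
  have mult_in: "(\<lambda>i. int a * z i mod q i) \<in> A" if "z \<in> A" for a z
    using goodD(3)[OF A that that, of "int a" 0] by (simp add: lincomb_def)
  have "(\<lambda>i. int (nat p) * h x i mod q i) = h (\<lambda>i. int (nat p) * x i mod q i)"
    by (rule hom_grp_mult[OF A B h xA, symmetric])
  also have "\<dots> = (\<lambda>i. (h (\<lambda>i. int c1 * e i mod q i) i + h (\<lambda>i. int c2 * y i mod q i) i) mod q i)"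
    unfolding decomp using h mult_in[OF eA, of c1] mult_in[OF yA, of c2] by (simp add: hom_def)
  also have "\<dots> = (\<lambda>i. (int c1 * h e i mod q i + int c2 * h y i mod q i) mod q i)"
    by (simp only: hom_grp_mult[OF A B h eA] hom_grp_mult[OF A B h yA])
  finally have "int (nat p) * h x (j k) mod q (j k) =
      (int c1 * h e (j k) mod q (j k) + int c2 * h y (j k) mod q (j k)) mod q (j k)" by meson
  also have "\<dots> = (p * gen n F (j k) * h e (j k)) mod q (j k)"
  proof -
    have "int c2 * h y (j k) mod q (j k) = 0" unfolding c by simp
    moreover have "int c1 * h e (j k) mod q (j k) = (p * gen n F (j k) * h e (j k)) mod q (j k)"
      unfolding c x_def by (metis mod_mult_left_eq mod_mult_right_eq)
    ultimately show ?thesis by simp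
  qed
  finally have "q (j k) dvd p * h x (j k) - p * gen n F (j k) * h e (j k)"
    unfolding c by (simp add: mod_eq_dvd_iff)
  then show ?thesis by (simp add: p_def x_def right_diff_distrib mult.assoc)
qed

text \<open>\<open>hom_diagonal\<close>, applied to the polynomials 1 and \<open>F\<close>, gives
  two congruences with the same unknown scalar at \<open>j k\<close>. Eliminating it shows that
  \<open>h\<close> acts on rational polynomials as multiplication by \<open>g\<close> over
  \<open>d\<close>, the image of 1: the cross-multiplied identity holds at \<open>\<alpha> k\<close>
  in the sense of \<open>poly_eq_0I\<close>.\<close>

lemma hom_polynomial:
  assumes B: "good B" and h: "h \<in> hom (grp (ext UNIV)) (grp B)"
    and g: "approx (h (\<lambda>i. gen 1 1 i mod q i)) d g" "0 < d"
    and F': "approx (h (\<lambda>i. gen n F i mod q i)) n' F'" "0 < n" "0 < n'"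
  shows "Polynomial.smult (n * d) F' = Polynomial.smult n' (g * F)"
proof -
  define x1 x where "x1 = (\<lambda>i. gen 1 1 i mod q i)" and "x = (\<lambda>i. gen n F i mod q i)"
  let ?H = "Polynomial.smult (n * d) F' - Polynomial.smult n' (g * F)"
  let ?S = "{i. \<not> q i dvd h x1 i - gen d g i} \<union> {i. \<not> q i dvd h x i - gen n' F' i}"
  let ?N = "n * n' * d"
  have N: "?N > 0" using g F' by simp
  have "finite ?S" using g F' by (simp add: approx_def x1_def x_def)
  then have "finite (j -` ?S)" by (intro finite_vimageI inj_j)
  then have "infinite ({k. ?N \<le> int k} - j -` ?S)"
  proof (intro Diff_infinite_finite)
    have "{k. ?N \<le> int k} = {nat ?N..}" by auto
    then show "infinite {k. ?N \<le> int k}" by (simp only: infinite_Ici not_False_eq_True)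
  qed
  moreover have "{k. ?N \<le> int k} - j -` ?S \<subseteq> {k. q (j k) dvd (m k)\<^sup>2 * poly ?H (\<alpha> k)}"
  proof
    fix k assume "k \<in> {k. ?N \<le> int k} - j -` ?S"
    then have k: "?N \<le> int k" "q (j k) dvd h x1 (j k) - gen d g (j k)" "q (j k) dvd h x (j k) - gen n' F' (j k)"
      by auto
    define p where "p = (\<Prod>l<k. q (j l))"
    define \<phi> where "\<phi> = h (\<lambda>i. if i = j k then 1 mod q i else 0) (j k)"
    define G F0 F1 where "G = poly g (\<alpha> k)" and "F0 = poly F (\<alpha> k)" and "F1 = poly F' (\<alpha> k)"
    obtain t where t: "m k = ?N * t" using dvd_m[OF N k(1)] by (auto elim: dvdE)
    have "1 \<le> ?N" using N by linarith
    have "n * 1 \<le> n * (n' * d)" using g F' by (intro mult_left_mono) (auto simp: int_one_le_iff_zero_less)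
    then have "n \<le> ?N" by (simp add: mult.assoc)
    have gens: "gen n F (j k) = n' * d * t * F0" "gen n' F' (j k) = n * d * t * F1"
      "gen d g (j k) = n * n' * t * G" "gen 1 1 (j k) = m k"
      using t g F' by (simp_all add: gen_j G_def F0_def F1_def mult.assoc mult.left_commute)
    have 1: "q (j k) dvd p * (h x1 (j k) - m k * \<phi>)"
      using hom_diagonal[OF B h, of 1 k 1] \<open>1 \<le> ?N\<close> k(1) unfolding gens by (simp add: p_def x1_def \<phi>_def)
    have 2: "q (j k) dvd p * (h x (j k) - n' * d * t * F0 * \<phi>)"
      using hom_diagonal[OF B h, of n k F] \<open>n \<le> ?N\<close> k(1) F' unfolding gens by (simp add: p_def x_def \<phi>_def)
    have "q (j k) dvd p * (n * n' * t * G - m k * \<phi>)"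
      using dvd_diff[OF 1 dvd_mult[OF k(2), of p]] by (simp add: gens algebra_simps)
    \<comment> \<open>The multipliers here and in the congruence for \<open>F\<close> are chosen so
      that the terms with the scalar \<open>\<phi>\<close> coincide and cancel in the
      difference.\<close>
    then have 3: "q (j k) dvd n' * F0 * d * (p * (n * n' * t * G - m k * \<phi>))" by (rule dvd_mult)
    have "q (j k) dvd p * (n * d * t * F1 - n' * d * t * F0 * \<phi>)"
      using dvd_diff[OF 2 dvd_mult[OF k(3), of p]] by (simp add: gens algebra_simps)
    then have 4: "q (j k) dvd n * n' * d * (p * (n * d * t * F1 - n' * d * t * F0 * \<phi>))" by (rule dvd_mult)
    have "q (j k) dvd p * m k * (n * d * F1 - n' * (G * F0))"
      using dvd_diff[OF 4 3] by (simp add: t algebra_simps)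
    \<comment> \<open>The factorial completes \<open>p\<close> to a second factor
      \<open>m k\<close>.\<close>
    then have "q (j k) dvd fact k * (p * m k * (n * d * F1 - n' * (G * F0)))" by (rule dvd_mult)
    also have "\<dots> = (m k)\<^sup>2 * poly ?H (\<alpha> k)"
      by (simp add: power2_eq_square G_def F0_def F1_def) (simp add: m_def p_def algebra_simps)
    finally show "k \<in> {k. q (j k) dvd (m k)\<^sup>2 * poly ?H (\<alpha> k)}" by simp
  qed
  ultimately have "infinite {k. q (j k) dvd (m k)\<^sup>2 * poly ?H (\<alpha> k)}" using finite_subset by blast
  then have "?H = 0" by (rule poly_eq_0I)
  then show ?thesis by simp
qed

text \<open>This group contains 1 and all multiples of the square of the variable, but it is not
  closed under multiplication by the variable.\<close>

definition no_linear :: "int poly set" where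
  "no_linear = {F. Polynomial.coeff F 1 = 0}"

lemma good_ext_no_linear: "good (ext no_linear)"
  by (rule good_ext) (auto simp: no_linear_def)

text \<open>An isomorphism multiplies by \<open>g\<close> over \<open>d\<close>. Since 1 lies in
  \<open>no_linear\<close>, it has a preimage, so \<open>g\<close> divides a nonzero constant and is
  itself a nonzero constant. Then the image of the variable has a nonzero linear term.\<close>

lemma not_iso: "\<not> grp (ext UNIV) \<cong> grp (ext no_linear)"
proof
  assume "grp (ext UNIV) \<cong> grp (ext no_linear)"
  then obtain h where "h \<in> iso (grp (ext UNIV)) (grp (ext no_linear))" by (auto simp: is_iso_def)
  then have h: "h \<in> hom (grp (ext UNIV)) (grp (ext no_linear))" and surj: "h ` ext UNIV = ext no_linear"
    by (auto simp: iso_def bij_betw_def)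
  have hE: "h x \<in> ext no_linear" if "x \<in> ext UNIV" for x using surj that by auto
  define g' where "g' n F = (\<lambda>i. gen n F i mod q i)" for n F
  have g': "g' n F \<in> ext UNIV" if "n > 0" for n F unfolding g'_def using that by (intro gen_in_ext) auto
  obtain d g where dg: "d > 0" "approx (h (g' 1 1)) d g" using hE[OF g'[of 1 1]] by (auto simp: ext_def)
  note poly = hom_polynomial[OF good_ext_no_linear h dg(2)[unfolded g'_def] dg(1)]
  have "g' 1 1 \<in> ext no_linear"
    unfolding g'_def by (rule gen_in_ext) (auto simp: no_linear_def)
  then have "g' 1 1 \<in> h ` ext UNIV" by (simp only: surj)
  then obtain x where x: "x \<in> ext UNIV" "h x = g' 1 1" by (metis imageE)
  then obtain n F where nF: "n > 0" "approx x n F" by (auto simp: ext_def)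
  \<comment> \<open>The preimage \<open>x\<close> is replaced by the standard representative of its
    polynomial; they differ by an element of the direct sum, and so do their images.\<close>
  have "finite {i. h x i \<noteq> h (g' n F) i}"
  proof (rule hom_grp_finite_diff[OF good_ext_UNIV good_ext_no_linear h x(1) g'[OF nF(1)]])
    have "x i = g' n F i" if "q i dvd x i - gen n F i" for i
      using that x(1) full_mod_eq[of x i] by (simp add: g'_def mod_eq_dvd_iff[symmetric] ext_def)
    then have "{i. x i \<noteq> g' n F i} \<subseteq> {i. \<not> q i dvd x i - gen n F i}" by auto
    then show "finite {i. x i \<noteq> g' n F i}" using nF(2) unfolding approx_def by (rule finite_subset)
  qed
  moreover have "q i dvd h (g' n F) i - gen 1 1 i" if "h x i = h (g' n F) i" for i
  proof -
    have "h (g' n F) i = gen 1 1 i mod q i" using that x(2) by (simp add: g'_def)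
    then show ?thesis by (simp add: mod_eq_dvd_iff[symmetric])
  qed
  then have "{i. \<not> q i dvd h (g' n F) i - gen 1 1 i} \<subseteq> {i. h x i \<noteq> h (g' n F) i}" by auto
  ultimately have "approx (h (g' n F)) 1 1" unfolding approx_def using finite_subset by blast
  from poly[OF this[unfolded g'_def] nF(1)] have gF: "g * F = [:n * d:]" by (simp add: one_pCons)
  then have "g * F \<noteq> 0" using nF dg by simp
  then have "g \<noteq> 0" "Polynomial.degree g + Polynomial.degree F = Polynomial.degree (g * F)"
    by (auto simp: Polynomial.degree_mult_eq)
  then obtain c where c: "g = [:c:]" "c \<noteq> 0" by (auto simp: gF elim: degree_eq_zeroE)
  obtain n' F' where *: "n' > 0" "F' \<in> no_linear" "approx (h (g' 1 [:0, 1:])) n' F'"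
    using hE[OF g'[of 1 "[:0, 1:]"]] by (auto simp: ext_def)
  from poly[OF *(3)[unfolded g'_def] _ *(1)]
  have "Polynomial.smult d F' = Polynomial.smult n' (g * [:0, 1:])" by simp
  then have "Polynomial.coeff (Polynomial.smult d F') 1 = Polynomial.coeff (Polynomial.smult n' (g * [:0, 1:])) 1"
    by (rule arg_cong)
  then have "d * Polynomial.coeff F' 1 = n' * c" by (simp add: c(1))
  then show False using * c(2) by (simp add: no_linear_def)
qed

text \<open>\<open>twist\<close> is an isomorphism onto the subgroup of the multiples of the squared
  variable. That subgroup is good and contained in \<open>ext no_linear\<close>, so
  \<open>good_elementary\<close> applies to the inclusion.\<close>

lemma elementary_embedding_twist: "elementary_embedding (grp (ext UNIV)) (grp (ext no_linear)) twist"
proof -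
  let ?W = "range ((*) (Polynomial.monom 1 2 :: int poly))"
  have "good (ext ?W)"
  proof (rule good_ext)
    show "0 \<in> ?W" by (metis mult_zero_right rangeI)
    fix F G :: "int poly" and a b assume "F \<in> ?W" "G \<in> ?W"
    then obtain F' G' where "F = Polynomial.monom 1 2 * F'" "G = Polynomial.monom 1 2 * G'" by auto
    then have "Polynomial.smult a F + Polynomial.smult b G = Polynomial.monom 1 2 * (Polynomial.smult a F' + Polynomial.smult b G')"
      by (simp only: distrib_left mult_smult_right)
    then show "Polynomial.smult a F + Polynomial.smult b G \<in> ?W" by (metis rangeI)
  qed
  then have good: "good (twist ` ext UNIV)" by (simp only: twist_image)
  have "?W \<subseteq> no_linear" by (auto simp: no_linear_def coeff_monom_mult)
  then have "ext ?W \<subseteq> ext no_linear" by (rule ext_mono)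
  then have sub: "twist ` ext UNIV \<subseteq> ext no_linear" by (simp only: twist_image)
  have "sat (grp (ext UNIV)) v \<phi> \<longleftrightarrow> sat (grp (ext no_linear)) (twist \<circ> v) \<phi>"
    if "range v \<subseteq> ext UNIV" for v \<phi>
  proof -
    have "range (twist \<circ> v) \<subseteq> twist ` ext UNIV" using that by auto
    then show ?thesis
      using sat_iso[OF twist_iso fo_structure_grp[OF good_ext_UNIV]] that
        good_elementary[OF good good_ext_no_linear sub] by simp
  qed
  then show ?thesis using sub by (auto simp: elementary_embedding_def)
qed

lemma elementary_embedding_id: "elementary_embedding (grp (ext no_linear)) (grp (ext UNIV)) id"
proof -
  have "ext no_linear \<subseteq> ext UNIV" by (rule ext_mono) simp
  then show ?thesis
    using good_elementary[OF good_ext_no_linear good_ext_UNIV] by (auto simp: elementary_embedding_def)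
qed

end


section \<open>Reduced models in the given type\<close>

lemma holds_in_sentence:
  assumes "sentence \<phi>" "range v \<subseteq> carrier M"
  shows "holds_in M \<phi> \<longleftrightarrow> sat M v \<phi>"
proof -
  have "sat M w \<phi> \<longleftrightarrow> sat M v \<phi>" for w
    by (rule sat_cong_free_vars) (use assms(1) in \<open>simp add: sentence_def\<close>)
  then show ?thesis using assms(2) by (auto simp: holds_in_def)
qed

lemma elementary_embedding_iso:
  "h \<in> iso M N \<Longrightarrow> fo_structure M \<Longrightarrow> elementary_embedding M N h"
  using sat_iso[of h M N] by (auto simp: elementary_embedding_def iso_def hom_def)

lemma elementary_embedding_comp:
  fixes M :: "'a monoid"
  assumes "elementary_embedding M N f" "elementary_embedding N P g"
  shows "elementary_embedding M P (g \<circ> f)"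
  unfolding elementary_embedding_def
proof (intro conjI allI impI)
  show "g \<circ> f \<in> carrier M \<rightarrow> carrier P" using assms by (auto simp: elementary_embedding_def)
  fix \<phi> and v :: "nat \<Rightarrow> 'a" assume v: "range v \<subseteq> carrier M"
  then have "range (f \<circ> v) \<subseteq> carrier N" using assms(1) by (auto simp: elementary_embedding_def)
  with v show "sat M v \<phi> \<longleftrightarrow> sat P (g \<circ> f \<circ> v) \<phi>"
    using assms unfolding elementary_embedding_def comp_assoc by blast
qed

lemma Th_eq_embedding:
  fixes M :: "'a monoid"
  assumes "elementary_embedding M N f" "fo_structure M" "fo_structure N"
  shows "Th M = Th N"
proof -
  obtain a where a: "a \<in> carrier M" using assms(2) by (auto simp: fo_structure_def)
  have "holds_in M \<phi> \<longleftrightarrow> holds_in N \<phi>" if "sentence \<phi>" for \<phi>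
  proof -
    define v :: "nat \<Rightarrow> 'a" where "v = (\<lambda>_. a)"
    have v: "range v \<subseteq> carrier M" "range (f \<circ> v) \<subseteq> carrier N"
      using a assms(1) by (auto simp: elementary_embedding_def v_def)
    then have "sat M v \<phi> \<longleftrightarrow> sat N (f \<circ> v) \<phi>"
      using assms(1) unfolding elementary_embedding_def by blast
    then show ?thesis using holds_in_sentence[OF that v(1)] holds_in_sentence[OF that v(2)] by simp
  qed
  then show ?thesis by (auto simp: Th_def)
qed

lemma fo_structure_group: "group M \<Longrightarrow> fo_structure M"
  using group.is_monoid monoid.m_closed monoid.one_closed by (fastforce simp: fo_structure_def)

text \<open>An element of a divisible subgroup is divisible by every positive integer in the whole
  group, so it is enough to exclude such elements other than the identity.\<close>

lemma reduced_groupI: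
  assumes "group M"
    and "\<And>x. x \<in> carrier M \<Longrightarrow> \<forall>n>0. \<exists>y\<in>carrier M. y [^]\<^bsub>M\<^esub> (n :: nat) = x \<Longrightarrow> x = \<one>\<^bsub>M\<^esub>"
  shows "reduced_group M"
  unfolding reduced_group_def
proof (intro allI impI)
  fix H assume H: "subgroup H M \<and> divisible_group (M\<lparr>carrier := H\<rparr>)"
  then have sub: "H \<subseteq> carrier M" "\<one>\<^bsub>M\<^esub> \<in> H" by (auto simp: subgroup_def)
  have "x = \<one>\<^bsub>M\<^esub>" if x: "x \<in> H" for x
  proof (rule assms(2))
    show "x \<in> carrier M" using x sub by auto
    show "\<forall>n>0. \<exists>y\<in>carrier M. y [^]\<^bsub>M\<^esub> (n :: nat) = x"
    proof (intro allI impI)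
      fix n :: nat assume "n > 0"
      then obtain y where "y \<in> H" "y [^]\<^bsub>M\<lparr>carrier := H\<rparr>\<^esub> n = x"
        using H x by (auto simp: divisible_group_def)
      moreover have "y [^]\<^bsub>M\<lparr>carrier := H\<rparr>\<^esub> n = y [^]\<^bsub>M\<^esub> n" by (simp add: nat_pow_def)
      ultimately show "\<exists>y\<in>carrier M. y [^]\<^bsub>M\<^esub> n = x" using sub by auto
    qed
  qed
  then show "H = {\<one>\<^bsub>M\<^esub>}" using sub(2) by blast
qed

lemma transport_comm_group:
  fixes M :: "'a monoid" and f :: "'a \<Rightarrow> 'b"
  assumes "comm_group M" "inj_on f (carrier M)"
  obtains N :: "'b monoid" where "comm_group N" "f \<in> iso M N"
proof -
  interpret comm_group M by fact
  define g where "g = inv_into (carrier M) f"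
  define N where "N = \<lparr>carrier = f ` carrier M, monoid.mult = (\<lambda>x y. f (g x \<otimes>\<^bsub>M\<^esub> g y)), one = f \<one>\<^bsub>M\<^esub>\<rparr>"
  have "f \<in> iso M N"
    using assms(2) by (auto simp: iso_def hom_def N_def g_def bij_betw_def)
  moreover have "N\<lparr>one := f \<one>\<^bsub>M\<^esub>\<rparr> = N" by (simp add: N_def)
  then have "comm_group N" using iso_imp_img_comm_group[OF \<open>f \<in> iso M N\<close>] by simp
  ultimately show ?thesis using that by blast
qed

section \<open>The direct sum as a group of residues\<close>

lemma finite_cyclic_group_pow:
  assumes "group C" "cyclic_group C" "finite (carrier C)"
  obtains g where "g \<in> carrier C"
    "bij_betw (\<lambda>k :: int. g [^]\<^bsub>C\<^esub> k) {0..<int (card (carrier C))} (carrier C)"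
    "\<And>k :: int. g [^]\<^bsub>C\<^esub> (k mod int (card (carrier C))) = g [^]\<^bsub>C\<^esub> k"
proof -
  interpret group C by fact
  obtain g where g: "g \<in> carrier C" "carrier C = range (\<lambda>n::int. g [^]\<^bsub>C\<^esub> n)"
    using assms(2) cyclic_group by auto
  have pos: "ord g > 0" using ord_ge_1[OF assms(3) g(1)] by simp
  have mod: "g [^]\<^bsub>C\<^esub> (k mod int (ord g)) = g [^]\<^bsub>C\<^esub> k" for k :: int
    unfolding int_pow_eq[OF g(1)] by (simp add: minus_mod_eq_mult_div)
  have bij: "bij_betw (\<lambda>k :: int. g [^]\<^bsub>C\<^esub> k) {0..<int (ord g)} (carrier C)"
    unfolding bij_betw_def
  proof
    show "inj_on (\<lambda>k :: int. g [^]\<^bsub>C\<^esub> k) {0..<int (ord g)}"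
    proof (rule inj_onI)
      fix x y :: int assume *: "x \<in> {0..<int (ord g)}" "y \<in> {0..<int (ord g)}"
      assume "g [^]\<^bsub>C\<^esub> x = g [^]\<^bsub>C\<^esub> y"
      then have "y mod int (ord g) = x mod int (ord g)"
        unfolding int_pow_eq[OF g(1)] by (simp only: mod_eq_dvd_iff)
      then show "x = y" using * by simp
    qed
    show "(\<lambda>k :: int. g [^]\<^bsub>C\<^esub> k) ` {0..<int (ord g)} = carrier C"
    proof
      show "carrier C \<subseteq> (\<lambda>k :: int. g [^]\<^bsub>C\<^esub> k) ` {0..<int (ord g)}"
      proof
        fix x assume "x \<in> carrier C"
        then obtain k :: int where "x = g [^]\<^bsub>C\<^esub> k" using g(2) by auto
        then have "x = g [^]\<^bsub>C\<^esub> (k mod int (ord g))" by (simp only: mod)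
        then show "x \<in> (\<lambda>k :: int. g [^]\<^bsub>C\<^esub> k) ` {0..<int (ord g)}"
          using pos by (intro image_eqI[of _ _ "k mod int (ord g)"]) auto
      qed
    qed (use g in auto)
  qed
  then have "card (carrier C) = ord g" using bij_betw_same_card by force
  then show ?thesis using that[OF g(1)] bij mod by simp
qed

lemma sum_group_iso_fsupp:
  fixes I :: "'i set" and C :: "'i \<Rightarrow> 'b monoid"
  assumes "\<And>i. i \<in> I \<Longrightarrow> group (C i) \<and> cyclic_group (C i) \<and> finite (carrier (C i))"
  obtains q :: "'i \<Rightarrow> int" and f where "residue_product q"
    "f \<in> iso (residue_product.grp q (residue_product.fsupp q)) (sum_group I C)"
proof -
  \<comment> \<open>Indices outside \<open>I\<close> get order 1. Residues there are forced to be
    zero, so summing over the whole index type adds nothing.\<close>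
  define q where "q i = (if i \<in> I then int (card (carrier (C i))) else 1)" for i
  have "q i > 0" for i
  proof (cases "i \<in> I")
    case True
    then have "carrier (C i) \<noteq> {}" "finite (carrier (C i))"
      using assms[OF True] group.is_monoid monoid.one_closed by fastforce+
    then show ?thesis using True by (simp add: q_def card_gt_0_iff)
  qed (simp add: q_def)
  then interpret residue_product q by unfold_locales
  have grp: "group (C i)" if "i \<in> I" for i using assms[OF that] by simp
  have "\<forall>i\<in>I. \<exists>g. g \<in> carrier (C i) \<and> bij_betw (\<lambda>k :: int. g [^]\<^bsub>C i\<^esub> k) {0..<q i} (carrier (C i)) \<and>
      (\<forall>k :: int. g [^]\<^bsub>C i\<^esub> (k mod q i) = g [^]\<^bsub>C i\<^esub> k)"
  proof
    fix i assume i: "i \<in> I"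
    then have "group (C i)" "cyclic_group (C i)" "finite (carrier (C i))" using assms by auto
    moreover have "q i = int (card (carrier (C i)))" using i by (simp add: q_def)
    ultimately obtain g where "g \<in> carrier (C i)"
      "bij_betw (\<lambda>k :: int. g [^]\<^bsub>C i\<^esub> k) {0..<q i} (carrier (C i))"
      "\<And>k :: int. g [^]\<^bsub>C i\<^esub> (k mod q i) = g [^]\<^bsub>C i\<^esub> k"
      using finite_cyclic_group_pow[of "C i"] by metis
    then show "\<exists>g. g \<in> carrier (C i) \<and>
        bij_betw (\<lambda>k :: int. g [^]\<^bsub>C i\<^esub> k) {0..<q i} (carrier (C i)) \<and>
        (\<forall>k :: int. g [^]\<^bsub>C i\<^esub> (k mod q i) = g [^]\<^bsub>C i\<^esub> k)" by blast
  qed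
  then obtain g where g: "\<And>i. i \<in> I \<Longrightarrow> g i \<in> carrier (C i)"
    "\<And>i. i \<in> I \<Longrightarrow> bij_betw (\<lambda>k :: int. g i [^]\<^bsub>C i\<^esub> k) {0..<q i} (carrier (C i))"
    "\<And>i k. i \<in> I \<Longrightarrow> g i [^]\<^bsub>C i\<^esub> ((k :: int) mod q i) = g i [^]\<^bsub>C i\<^esub> k"
    by metis
  define f where "f x = (\<lambda>i\<in>I. g i [^]\<^bsub>C i\<^esub> (x i :: int))" for x
  have pow1: "g i [^]\<^bsub>C i\<^esub> k = \<one>\<^bsub>C i\<^esub> \<longleftrightarrow> k = 0" if "i \<in> I" "k \<in> {0..<q i}" for i and k :: int
  proof -
    have "g i [^]\<^bsub>C i\<^esub> (0 :: int) = \<one>\<^bsub>C i\<^esub>" by simp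
    moreover have "0 \<in> {0..<q i}" using q_pos by simp
    ultimately show ?thesis
      using bij_betw_imp_inj_on[OF g(2)[OF that(1)]] that(2) by (metis inj_onD)
  qed
  have off: "x i = 0" if "x \<in> full" "i \<notin> I" for x i
    using fullD[OF that(1), of i] that(2) by (simp add: q_def)
  have rng: "x i \<in> {0..<q i}" if "x \<in> full" for x i using fullD[OF that] by simp
  have supp: "{i \<in> I. f x i \<noteq> \<one>\<^bsub>C i\<^esub>} = {i. x i \<noteq> 0}" if "x \<in> full" for x
    using pow1 rng[OF that] off[OF that] by (auto simp: f_def)
  have "f \<in> iso (grp fsupp) (sum_group I C)"
  proof (rule isoI)
    show "f \<in> hom (grp fsupp) (sum_group I C)"
    proof (rule homI)
      fix x assume "x \<in> carrier (grp fsupp)"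
      then have x: "x \<in> full" "finite {i. x i \<noteq> 0}" by (auto simp: fsupp_def)
      have "f x i \<in> carrier (C i)" if "i \<in> I" for i
        using that group.int_pow_closed[OF grp g(1)] by (simp add: f_def)
      then show "f x \<in> carrier (sum_group I C)"
        using x supp[OF x(1)] by (simp add: carrier_sum_group[OF grp] f_def PiE_iff)
    next
      fix x y assume "x \<in> carrier (grp fsupp)" "y \<in> carrier (grp fsupp)"
      have "g i [^]\<^bsub>C i\<^esub> ((x i + y i) mod q i) = g i [^]\<^bsub>C i\<^esub> x i \<otimes>\<^bsub>C i\<^esub> g i [^]\<^bsub>C i\<^esub> y i" if "i \<in> I" for i
        using g(3)[OF that] group.int_pow_mult[OF grp[OF that] g(1)[OF that]] by simp
      then show "f (x \<otimes>\<^bsub>grp fsupp\<^esub> y) = f x \<otimes>\<^bsub>sum_group I C\<^esub> f y"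
        by (auto simp: f_def)
    qed
    show "bij_betw f (carrier (grp fsupp)) (carrier (sum_group I C))"
      unfolding bij_betw_def
    proof
      show "inj_on f (carrier (grp fsupp))"
      proof (rule inj_onI)
        fix x y assume "x \<in> carrier (grp fsupp)" "y \<in> carrier (grp fsupp)" and eq: "f x = f y"
        then have xy: "x \<in> full" "y \<in> full" by (auto simp: fsupp_def)
        show "x = y"
        proof
          fix i show "x i = y i"
          proof (cases "i \<in> I")
            case True
            then have "g i [^]\<^bsub>C i\<^esub> x i = g i [^]\<^bsub>C i\<^esub> y i" using fun_cong[OF eq, of i] by (simp add: f_def)
            then show ?thesis
              using bij_betw_imp_inj_on[OF g(2)[OF True]] rng[OF xy(1), of i] rng[OF xy(2), of i]
              by (auto dest: inj_onD)
          qed (use off[OF xy(1)] off[OF xy(2)] in simp)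
        qed
      qed
      show "f ` carrier (grp fsupp) = carrier (sum_group I C)"
      proof
        show "f ` carrier (grp fsupp) \<subseteq> carrier (sum_group I C)"
          using \<open>f \<in> hom (grp fsupp) (sum_group I C)\<close> by (auto simp: hom_def)
        show "carrier (sum_group I C) \<subseteq> f ` carrier (grp fsupp)"
        proof
          fix z assume z: "z \<in> carrier (sum_group I C)"
          then have z': "z \<in> extensional I" "\<And>i. i \<in> I \<Longrightarrow> z i \<in> carrier (C i)"
            "finite {i \<in> I. z i \<noteq> \<one>\<^bsub>C i\<^esub>}" by (auto simp: carrier_sum_group[OF grp] PiE_iff)
          have "\<exists>k. k \<in> {0..<q i} \<and> z i = g i [^]\<^bsub>C i\<^esub> k" if "i \<in> I" for i
            using z'(2)[OF that] bij_betw_imp_surj_on[OF g(2)[OF that]] by (metis imageE)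
          then obtain k where k: "\<And>i. i \<in> I \<Longrightarrow> k i \<in> {0..<q i} \<and> z i = g i [^]\<^bsub>C i\<^esub> k i" by metis
          define x where "x i = (if i \<in> I then k i else 0)" for i
          have "0 \<le> x i \<and> x i < q i" for i using k[of i] q_pos[of i] by (simp add: x_def)
          then have xf: "x \<in> full" by (simp add: full_def)
          have "f x i = z i" for i using k[of i] z'(1) by (auto simp: f_def x_def extensional_def)
          then have fx: "f x = z" by auto
          have "finite {i. x i \<noteq> 0}" using supp[OF xf] fx z'(3) by simp
          then show "z \<in> f ` carrier (grp fsupp)" using xf fx by (auto simp: fsupp_def)
        qed
      qed
    qed
  qed
  then show ?thesis using that residue_product_axioms by blast
qed

section \<open>Realisation on the type of the given group\<close>

lemma (in sparse_sequence) ext_embeds: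
  "\<exists>f. inj_on f (ext W) \<and> f ` ext W \<subseteq> fsupp"
proof -
  \<comment> \<open>The shift to \<open>Suc k\<close> makes the order exceed 1 by
    \<open>q_increasing\<close>, so that 1 is an admissible residue.\<close>
  define e where "e k = (\<lambda>i. if i = j (Suc k) then 1 else 0 :: int)" for k
  have big: "q (j (Suc k)) > 1" for k
    using q_increasing[of 0 "Suc k"] q_pos[of "j 0"] by simp
  have "e k \<in> fsupp" for k
  proof -
    have "{i. e k i \<noteq> 0} = {j (Suc k)}" by (auto simp: e_def)
    moreover have "e k \<in> full" using big q_pos by (auto simp: e_def full_def)
    ultimately show ?thesis by (simp add: fsupp_def)
  qed
  moreover have "inj e"
  proof (rule injI)
    fix k l assume "e k = e l"
    from fun_cong[OF this, of "j (Suc k)"] have "j (Suc k) = j (Suc l)" by (auto simp: e_def split: if_splits)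
    then show "k = l" using inj_j by (auto dest: injD)
  qed
  ultimately have inf: "infinite fsupp" by (metis image_subsetI infinite_iff_countable_subset)
  \<comment> \<open>There are countably many pairs of denominator and numerator, so
    \<open>ext W\<close> lies in countably many cosets of the direct sum. The infinite direct sum
    absorbs this countable factor, hence it has room for a copy of \<open>ext W\<close>.\<close>
  then have "\<exists>p. inj_on p ((UNIV :: nat set) \<times> fsupp) \<and> p ` (UNIV \<times> fsupp) \<subseteq> fsupp"
    using card_of_Times_infinite[of fsupp "UNIV :: nat set"] infinite_iff_card_of_nat[of fsupp]
    unfolding card_of_ordLeq by (metis UNIV_not_empty ordIso_iff_ordLeq)
  then obtain p where p: "inj_on p ((UNIV :: nat set) \<times> fsupp)" "p ` (UNIV \<times> fsupp) \<subseteq> fsupp" by blast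
  have "\<forall>x\<in>ext W. \<exists>c. approx x (fst c) (snd c)" by (auto simp: ext_def)
  then obtain c where c: "\<And>x. x \<in> ext W \<Longrightarrow> approx x (fst (c x)) (snd (c x))" by metis
  define G where "G x = gen (fst (c x)) (snd (c x))" for x
  \<comment> \<open>An element is recovered from the code of its fraction and its difference from
    the chosen representative; this difference lies in the direct sum.\<close>
  define s where "s x = lincomb 1 x (-1) (G x)" for x
  define code where "code x = to_nat (fst (c x), coeffs (snd (c x)))" for x
  have s: "s x \<in> fsupp" if "x \<in> ext W" for x
  proof -
    have "{i. s x i \<noteq> 0} \<subseteq> {i. \<not> q i dvd x i - G x i}"
      by (auto simp: s_def lincomb_def dvd_eq_mod_eq_0)
    moreover have "finite {i. \<not> q i dvd x i - G x i}" using c[OF that] by (simp add: approx_def G_def)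
    ultimately show ?thesis using lincomb_full finite_subset by (auto simp: fsupp_def s_def)
  qed
  have "inj_on (\<lambda>x. p (code x, s x)) (ext W)"
  proof (rule inj_onI)
    fix x y assume xy: "x \<in> ext W" "y \<in> ext W" and "p (code x, s x) = p (code y, s y)"
    then have *: "code x = code y" "s x = s y" using p(1) s by (auto dest!: inj_onD)
    from *(1) have "c x = c y"
      by (simp add: code_def prod_eq_iff coeffs_eq_iff)
    then have "G x = G y" by (simp add: G_def)
    have full: "x \<in> full" "y \<in> full" using xy by (auto simp: ext_def)
    show "x = y"
    proof
      fix i
      have "(x i - G x i) mod q i = (y i - G x i) mod q i"
        using fun_cong[OF *(2), of i] \<open>G x = G y\<close> by (simp add: s_def lincomb_def)
      then have "(x i - G x i + G x i) mod q i = (y i - G x i + G x i) mod q i" by (metis mod_add_left_eq)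
      then show "x i = y i" using full by (simp add: full_mod_eq)
    qed
  qed
  moreover have "(\<lambda>x. p (code x, s x)) ` ext W \<subseteq> fsupp" using p(2) s by auto
  ultimately show ?thesis by blast
qed

text \<open>The map \<open>f\<close> followed by \<open>f0\<close> carries \<open>A\<close> into the
  type of \<open>G\<close>. An element divisible by \<open>q i\<close> has coordinate zero at
  \<open>i\<close>, so the copy is reduced. Its theory is that of the direct sum, an elementary
  substructure of \<open>A\<close>.\<close>

lemma (in residue_product) transport_grp:
  fixes G :: "'a monoid"
  assumes A: "good A" and f0: "f0 \<in> iso (grp fsupp) G" "group G" and f: "inj_on f A" "f ` A \<subseteq> fsupp"
  obtains M :: "'a monoid" and h
  where "comm_group M" "reduced_group M" "model_of M (Th G)" "h \<in> iso (grp A) M"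
proof -
  have "inj_on f0 fsupp" using f0(1) by (simp add: iso_def bij_betw_def)
  then have "inj_on (f0 \<circ> f) (carrier (grp A))"
    using f by (simp add: comp_inj_on inj_on_subset)
  then obtain M :: "'a monoid" where M: "comm_group M" "f0 \<circ> f \<in> iso (grp A) M"
    using transport_comm_group[OF comm_group_grp[OF A]] by blast
  define h where "h = f0 \<circ> f"
  have h: "h \<in> iso (grp A) M" using M(2) by (simp add: h_def)
  have grps: "group M" "group (grp A)" using M(1) comm_group_grp[OF A] by (simp_all add: comm_group_def)
  have hom: "h \<in> hom (grp A) M" and bij: "bij_betw h A (carrier M)" using h by (simp_all add: iso_def)
  have "reduced_group M"
  proof (rule reduced_groupI[OF grps(1)])
    fix x assume "x \<in> carrier M" and div: "\<forall>n>0. \<exists>y\<in>carrier M. y [^]\<^bsub>M\<^esub> (n :: nat) = x"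
    then obtain a where a: "a \<in> A" "x = h a" using bij_betw_imp_surj_on[OF bij] by blast
    have "a i = 0" for i
    proof -
      obtain y where "y \<in> carrier M" "y [^]\<^bsub>M\<^esub> nat (q i) = x" using div q_pos by (metis zero_less_nat_eq)
      moreover from this(1) obtain b where b: "b \<in> A" "y = h b" using bij_betw_imp_surj_on[OF bij] by blast
      ultimately have "h (b [^]\<^bsub>grp A\<^esub> nat (q i)) = h a"
        using hom_nat_pow[OF hom _ grps(2,1), of b] a by simp
      moreover have "b [^]\<^bsub>grp A\<^esub> nat (q i) \<in> A"
        using monoid.nat_pow_closed[OF group.is_monoid[OF grps(2)], of b "nat (q i)"] b(1) by simp
      ultimately have "b [^]\<^bsub>grp A\<^esub> nat (q i) = a"
        using bij_betw_imp_inj_on[OF bij] a(1) by (auto dest: inj_onD)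
      then have "a i = (int (nat (q i)) * b i) mod q i"
        using grp_pow[OF goodD(4)[OF A b(1)]] by metis
      then show ?thesis using q_pos[of i] by simp
    qed
    then have "a = \<one>\<^bsub>grp A\<^esub>" by auto
    then show "x = \<one>\<^bsub>M\<^esub>" using hom_one[OF hom grps(2,1)] a(2) by metis
  qed
  moreover have "Th G = Th M"
  proof -
    have "elementary_embedding (grp fsupp) (grp A) id"
      using good_elementary[OF good_fsupp A goodD(1)[OF A]] goodD(1)[OF A]
      by (auto simp: elementary_embedding_def)
    then have "Th (grp fsupp) = Th (grp A)"
      by (rule Th_eq_embedding) (rule fo_structure_grp good_fsupp A)+
    moreover have "Th (grp A) = Th M"
      by (rule Th_eq_embedding[OF elementary_embedding_iso[OF h]])
        (rule fo_structure_grp A fo_structure_group grps)+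
    moreover have "Th (grp fsupp) = Th G"
      by (rule Th_eq_embedding[OF elementary_embedding_iso[OF f0(1)]])
        (rule fo_structure_grp good_fsupp fo_structure_group f0)+
    ultimately show ?thesis by simp
  qed
  then have "model_of M (Th G)"
    using fo_structure_group[OF grps(1)] by (simp add: model_of_def Th_def)
  ultimately show ?thesis using that M(1) h by blast
qed

text \<open>A common multiple of all orders would annihilate the direct sum, and with it
  \<open>G\<close>.\<close>

lemma (in residue_product) orders_unbounded:
  fixes G :: "'a monoid"
  assumes "f \<in> iso (grp fsupp) G" "group G"
    and "\<not> (\<exists>n::nat. n > 0 \<and> (\<forall>x\<in>carrier G. x [^]\<^bsub>G\<^esub> n = \<one>\<^bsub>G\<^esub>))" and "N > 0"
  shows "\<exists>i. \<not> q i dvd N"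
proof (rule ccontr)
  assume "\<nexists>i. \<not> q i dvd N"
  then have dvd: "q i dvd N" for i by blast
  have hom: "f \<in> hom (grp fsupp) G" using assms(1) by (simp add: iso_def)
  have grp: "group (grp fsupp)" using comm_group_grp[OF good_fsupp] by (simp add: comm_group_def)
  have "x [^]\<^bsub>G\<^esub> nat N = \<one>\<^bsub>G\<^esub>" if x: "x \<in> carrier G" for x
  proof -
    obtain y where y: "y \<in> fsupp" "x = f y" using assms(1) x by (auto simp: iso_def bij_betw_def)
    then have "x [^]\<^bsub>G\<^esub> nat N = f (y [^]\<^bsub>grp fsupp\<^esub> nat N)"
      using hom_nat_pow[OF hom _ grp assms(2), of y] by simp
    also have "y [^]\<^bsub>grp fsupp\<^esub> nat N = (\<lambda>i. (int (nat N) * y i) mod q i)"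
      using y(1) by (intro grp_pow) (simp add: fsupp_def)
    also have "\<dots> = \<one>\<^bsub>grp fsupp\<^esub>" using dvd \<open>N > 0\<close> by (auto simp: fun_eq_iff)
    finally show ?thesis using hom_one[OF hom grp assms(2)] by simp
  qed
  then show False using assms(3) \<open>N > 0\<close> by (metis zero_less_nat_eq)
qed

theorem theorem3p10:
  fixes G :: "'a monoid" and I :: "'i set" and C :: "'i \<Rightarrow> 'b monoid"
  assumes "comm_group G"
    and "\<And>i. i \<in> I \<Longrightarrow> group (C i) \<and> cyclic_group (C i) \<and> finite (carrier (C i))"
    and "G \<cong> sum_group I C"
    and "\<not> (\<exists>n::nat. n > 0 \<and> (\<forall>x\<in>carrier G. x [^]\<^bsub>G\<^esub> n = \<one>\<^bsub>G\<^esub>))"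
  shows "\<not> Schroeder_Bernstein TYPE('a) (Th G) \<and>
    (\<exists>(M :: 'a monoid) (N :: 'a monoid).
       comm_group M \<and> reduced_group M \<and> model_of M (Th G) \<and>
       comm_group N \<and> reduced_group N \<and> model_of N (Th G) \<and>
       elementarily_biembeddable M N \<and> \<not> M \<cong> N)"
proof -
  have G: "group G" using assms(1) by (simp add: comm_group_def)
  obtain q :: "'i \<Rightarrow> int" and f where "residue_product q"
    and f: "f \<in> iso (residue_product.grp q (residue_product.fsupp q)) (sum_group I C)"
    by (rule sum_group_iso_fsupp[OF assms(2)])
  interpret residue_product q by fact
  obtain g where "g \<in> iso G (sum_group I C)" using assms(3) by (auto simp: is_iso_def)
  then have "inv_into (carrier G) g \<in> iso (sum_group I C) G" by (rule group.iso_set_sym[OF G])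
  from iso_set_trans[OF f this] obtain f0 where f0: "f0 \<in> iso (grp fsupp) G" by blast
  obtain j r \<alpha> u where "sparse_sequence q j r \<alpha> u"
    using sparse_sequence_exists orders_unbounded[OF f0 G assms(4)] by blast
  then interpret sparse_sequence q j r \<alpha> u .
  obtain e1 e2 where e: "inj_on e1 (ext UNIV)" "e1 ` ext UNIV \<subseteq> fsupp"
    "inj_on e2 (ext no_linear)" "e2 ` ext no_linear \<subseteq> fsupp"
    using ext_embeds by metis
  obtain M :: "'a monoid" and h where M: "comm_group M" "reduced_group M" "model_of M (Th G)"
    and h: "h \<in> iso (grp (ext UNIV)) M"
    using transport_grp[OF good_ext_UNIV f0 G e(1,2)] by blast
  obtain N :: "'a monoid" and k where N: "comm_group N" "reduced_group N" "model_of N (Th G)"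
    and k: "k \<in> iso (grp (ext no_linear)) N"
    using transport_grp[OF good_ext_no_linear f0 G e(3,4)] by blast
  have grps: "group (grp (ext UNIV))" "group (grp (ext no_linear))"
    using comm_group_grp good_ext_UNIV good_ext_no_linear by (simp_all add: comm_group_def)
  have fo: "fo_structure M" "fo_structure N" using M(3) N(3) by (simp_all add: model_of_def)
  have h': "inv_into (carrier (grp (ext UNIV))) h \<in> iso M (grp (ext UNIV))"
    by (rule group.iso_set_sym[OF grps(1) h])
  have k': "inv_into (carrier (grp (ext no_linear))) k \<in> iso N (grp (ext no_linear))"
    by (rule group.iso_set_sym[OF grps(2) k])
  \<comment> \<open>The two embeddings pass through the concrete groups: \<open>twist\<close> leads
    from the copy of \<open>ext UNIV\<close> to that of \<open>ext no_linear\<close>, the inclusion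
    leads back.\<close>
  have "elementarily_biembeddable M N"
    unfolding elementarily_biembeddable_def
    using elementary_embedding_comp[OF elementary_embedding_comp[OF
        elementary_embedding_iso[OF h' fo(1)] elementary_embedding_twist]
        elementary_embedding_iso[OF k fo_structure_group[OF grps(2)]]]
      elementary_embedding_comp[OF elementary_embedding_comp[OF
        elementary_embedding_iso[OF k' fo(2)] elementary_embedding_id]
        elementary_embedding_iso[OF h fo_structure_group[OF grps(1)]]]
    by blast
  moreover have "\<not> M \<cong> N"
  proof
    assume MN: "M \<cong> N"
    have 1: "grp (ext UNIV) \<cong> M" and 2: "N \<cong> grp (ext no_linear)"
      using h k' by (auto simp: is_iso_def)
    show False using not_iso iso_trans[OF iso_trans[OF 1 MN] 2] by contradiction
  qed
  moreover from calculation have "\<not> Schroeder_Bernstein TYPE('a) (Th G)"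
    using M(3) N(3) unfolding Schroeder_Bernstein_def by metis
  ultimately show ?thesis using M N by metis
qed


end
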